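(* Consider the problem $\min_{x\in\mathbb{R}^{d_x}}\{F(x):=\phi(x)-\psi(x)\}$ under the standing assumptions (i)–(iii) listed in the context, and let $\epsilon>0$. Suppose that the parameters $\gamma,\eta_0,\eta_1$ of the SMAG algorithm for difference-of-weakly-convex optimization (described in the context) are chosen as follows: $$0<\gamma<\min\{\delta_\phi^{-1},\delta_\psi^{-1}\},\quad \alpha=\min\Big\{\tfrac{1/\gamma-\delta_\phi}{2},\tfrac{1/\gamma-\delta_\psi}{2}\Big\},\quad \tau=\tfrac{\gamma^2\alpha^2}{4},\quad \nu=\min\Big\{1,\tfrac{2\tau}{\gamma^2\alpha}\Big\},$$ $$\eta_1=\min\Big\{\tfrac{\gamma^2(1/\gamma-\delta_\phi)}{2},\tfrac{\gamma^2(1/\gamma-\delta_\psi)}{2},\tfrac{1}{2L_F\tau},\tfrac{\min\{1,\gamma^2\}\min\{\alpha,\tau\}\nu\alpha}{768\,\tau M^2}\epsilon^2\Big\},\qquad \eta_0=\tau\eta_1,$$ where $L_F=\frac{2}{\gamma-\gamma^2\min\{\delta_\psi,\delta_\phi\}}$. Let $$P_0=\frac{2\tau}{\gamma^2\alpha}\Big(\mathbb{E}\|x_\phi^1-\mathrm{prox}_{\gamma\phi}(x_0)\|^2+\mathbb{E}\|x_\psi^1-\mathrm{prox}_{\gamma\psi}(x_0)\|^2\Big).$$ Then, whenever $$T\ge\frac{16\,(F_\gamma(x_0)-F_\gamma^*+P_0)}{\min\{1,\gamma^{-2}\}\min\{\alpha,\tau\}\,\nu\,\epsilon^2}\max\Big\{\tfrac{2}{\gamma^2(1/\gamma-\delta_\phi)},\tfrac{2}{\gamma^2(1/\gamma-\delta_\psi)},2L_F\tau,\tfrac{768\,\tau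 M^2}{\min\{1,\gamma^2\}\min\{\alpha,\tau\}\nu\alpha\epsilon^2}\Big\},$$ we have $$\frac1T\sum_{t=0}^{T-1}\Big(\mathbb{E}\|x_\phi^{t+1}-\mathrm{prox}_{\gamma\phi}(x_t)\|^2+\mathbb{E}\|x_\psi^{t+1}-\mathrm{prox}_{\gamma\psi}(x_t)\|^2+\mathbb{E}\|\nabla F_\gamma(x_t)\|^2\Big)\le\min\{1,\gamma^{-2}\}\frac{\epsilon^2}{4},$$ and consequently, with $\bar t$ sampled uniformly from $\{1,\dots,T\}$, the outputs $x_\phi^{\bar t}$ and $x_\psi^{\bar t}$ are both nearly $\epsilon$-critical points of the problem.
   Context: Setting. $\phi,\psi:\mathbb{R}^{d_x}\to\mathbb{R}$ are given in expectation form, $\phi(x)=\mathbb{E}_\xi[\phi(x;\xi)]$, $\psi(x)=\mathbb{E}_\zeta[\psi(x;\zeta)]$. $\|\cdot\|$ is the Euclidean norm. Definitions. A vector $v$ is a subgradient of $f$ at $x$ (with $f(x)$ finite) if $f(y)\ge f(x)+\langle v,y-x\rangle+o(\|y-x\|)$ as $y\to x$; $\partial f(x)$ is the set of all subgradients. $f$ is $\delta$-weakly convex if $f(\cdot)+\frac{\delta}{2}\|\cdot\|^2$ is convex. For a $\delta$-weakly convex $f$ and $\gamma\in(0,\delta^{-1})$, the Moreau envelope and proximal map are $f_\gamma(x)=\min_{x'}\{f(x')+\frac1{2\gamma}\|x'-x\|^2\}$ and $\mathrm{prox}_{\gamma f}(x)=\arg\min_{x'}\{f(x')+\frac1{2\gamma}\|x'-x\|^2\}$.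 Set $F_\gamma(x)=\phi_\gamma(x)-\psi_\gamma(x)$. A (random) vector $x$ is a nearly $\epsilon$-critical point of $\min_x\{\phi(x)-\psi(x)\}$ if there exist (random) $v,x',x''$ with $v\in\partial\phi(x')-\partial\psi(x'')$ and $\max\{\mathbb{E}\|v\|,\mathbb{E}\|x-x'\|,\mathbb{E}\|x-x''\|\}\le\epsilon$. Standing assumptions. (i) $\phi$ is $\delta_\phi$-weakly convex and $\psi$ is $\delta_\psi$-weakly convex. (ii) There is a constant $F_\gamma^*>-\infty$ with $F_\gamma^*\le F_\gamma(x)$ for all $x$. (iii) There is a finite constant $M$ such that $\mathbb{E}\|\tilde\partial\phi(x)\|^2\le M^2$ and $\mathbb{E}\|\tilde\partial\psi(x)\|^2\le M^2$ for all $x\in\mathbb{R}^{d_x}$. Here $\tilde\partial\phi(x)$, $\tilde\partial\psi(x)$ denote unbiased stochastic estimators of a subgradient of $\phi$, $\psi$ at $x$ (in the algorithm, unbiasedness and moment bounds hold conditionally on the past iterates). SMAG algorithm for difference-of-weakly-convex optimization. Given initial points $x_\phi^0,x_\psi^0,x_0\in\mathbb{R}^{d_x}$ and parameters $\gamma,\eta_0,\eta_1>0$, for $t=0,\dots,T-1$: $x_\phi^{t+1}=x_\phi^t-\eta_1\big(\tilde\partial\phi(x_\phi^t)+\frac1\gamma(x_\phi^t-x_t)\big)$; $x_\psi^{t+1}=x_\psi^t-\eta_1\big(\tilde\partial\psi(x_\psi^t)+\frac1\gamma(x_\psi^t-x_t)\big)$; $G_{t+1}=\frac1\gamma(x_\psi^{t+1}-x_\phi^{t+1})$;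 $x_{t+1}=x_t-\eta_0G_{t+1}$. It returns $x_\phi^{\bar t}$ or $x_\psi^{\bar t}$ with $\bar t$ uniformly sampled from $\{1,\dots,T\}$. *)

theory Defs
  imports "HOL-Probability.Probability" "HOL-Library.Landau_Symbols"
begin

definition subdifferential :: "('a::euclidean_space \<Rightarrow> real) \<Rightarrow> 'a \<Rightarrow> 'a set" where
  "subdifferential f x =
     {v. \<exists>r. r \<in> o[at x](\<lambda>y. norm (y - x)) \<and>
             (\<forall>\<^sub>F y in at x. f y \<ge> f x + inner v (y - x) + r y)}"

definition weakly_convex :: "real \<Rightarrow> ('a::euclidean_space \<Rightarrow> real) \<Rightarrow> bool" where
  "weakly_convex \<delta> f \<longleftrightarrow> convex_on UNIV (\<lambda>x. f x + \<delta> / 2 * (norm x)\<^sup>2)"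

definition moreau :: "real \<Rightarrow> ('a::euclidean_space \<Rightarrow> real) \<Rightarrow> 'a \<Rightarrow> real" where
  "moreau \<gamma> f x = (INF z. f z + 1 / (2 * \<gamma>) * (norm (z - x))\<^sup>2)"

definition prox :: "real \<Rightarrow> ('a::euclidean_space \<Rightarrow> real) \<Rightarrow> 'a \<Rightarrow> 'a" where
  "prox \<gamma> f x = arg_min (\<lambda>z. f z + 1 / (2 * \<gamma>) * (norm (z - x))\<^sup>2) (\<lambda>_. True)"

definition gradient :: "('a::euclidean_space \<Rightarrow> real) \<Rightarrow> 'a \<Rightarrow> 'a" where
  "gradient f x = (THE d. GDERIV f x :> d)"

definition subgradient_oracle ::
  "'b measure \<Rightarrow> ('a::euclidean_space \<Rightarrow> real) \<Rightarrow> real \<Rightarrow> ('a \<Rightarrow> 'b \<Rightarrow> 'a) \<Rightarrow> bool" where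
  "subgradient_oracle D f M g \<longleftrightarrow>
     (\<forall>x. g x \<in> borel_measurable D \<and>
          (\<integral>\<xi>. g x \<xi> \<partial>D) \<in> subdifferential f x \<and>
          (\<integral>\<^sup>+\<xi>. ennreal ((norm (g x \<xi>))\<^sup>2) \<partial>D) \<le> ennreal (M\<^sup>2))"

text \<open>Conditional expectation of a vector-valued random variable, taken coordinatewise.\<close>

definition vec_cond_exp ::
  "'w measure \<Rightarrow> 'w measure \<Rightarrow> ('w \<Rightarrow> 'a::euclidean_space) \<Rightarrow> 'w \<Rightarrow> 'a" where
  "vec_cond_exp P F X = (\<lambda>\<omega>. \<Sum>b\<in>Basis. real_cond_exp P F (\<lambda>\<omega>'. inner (X \<omega>') b) \<omega> *\<^sub>R b)"

text \<open>The random vector \<open>G\<close> estimates, conditionally on \<open>F\<close>, a subgradient of \<open>f\<close> at the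
  random point \<open>X\<close>, with conditional second moment at most \<open>M\<^sup>2\<close>. (Using \<open>nn_cond_exp\<close> in the
  moment bound forces \<open>G\<close> to be square-integrable, hence \<open>vec_cond_exp\<close> to be meaningful.)\<close>

definition cond_subgradient_estimator ::
  "'w measure \<Rightarrow> 'w measure \<Rightarrow> ('a::euclidean_space \<Rightarrow> real) \<Rightarrow> real \<Rightarrow> ('w \<Rightarrow> 'a) \<Rightarrow> ('w \<Rightarrow> 'a) \<Rightarrow> bool"
  where
  "cond_subgradient_estimator P F f M X G \<longleftrightarrow>
     G \<in> borel_measurable P \<and>
     (AE \<omega> in P. vec_cond_exp P F G \<omega> \<in> subdifferential f (X \<omega>)) \<and>
     (AE \<omega> in P. nn_cond_exp P F (\<lambda>\<omega>'. ennreal ((norm (G \<omega>'))\<^sup>2)) \<omega> \<le> ennreal (M\<^sup>2))"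

text \<open>Here \<open>g\<phi> t\<close> and \<open>g\<psi> t\<close> are the stochastic subgradients used in step \<open>t\<close>.\<close>

definition smag_iterates ::
  "nat \<Rightarrow> real \<Rightarrow> real \<Rightarrow> real \<Rightarrow> (nat \<Rightarrow> 'a::euclidean_space) \<Rightarrow> (nat \<Rightarrow> 'a) \<Rightarrow>
   (nat \<Rightarrow> 'a) \<Rightarrow> (nat \<Rightarrow> 'a) \<Rightarrow> (nat \<Rightarrow> 'a) \<Rightarrow> bool" where
  "smag_iterates T \<gamma> \<eta>\<^sub>0 \<eta>\<^sub>1 g\<phi> g\<psi> x\<phi> x\<psi> x \<longleftrightarrow>
     (\<forall>t<T.
        x\<phi> (Suc t) = x\<phi> t - \<eta>\<^sub>1 *\<^sub>R (g\<phi> t + (1 / \<gamma>) *\<^sub>R (x\<phi> t - x t)) \<and>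
        x\<psi> (Suc t) = x\<psi> t - \<eta>\<^sub>1 *\<^sub>R (g\<psi> t + (1 / \<gamma>) *\<^sub>R (x\<psi> t - x t)) \<and>
        (let G = (1 / \<gamma>) *\<^sub>R (x\<psi> (Suc t) - x\<phi> (Suc t)) in x (Suc t) = x t - \<eta>\<^sub>0 *\<^sub>R G))"

text \<open>Expectations of norms are taken in \<open>ennreal\<close>, so the bound includes integrability.\<close>

definition nearly_critical ::
  "'w measure \<Rightarrow> ('a::euclidean_space \<Rightarrow> real) \<Rightarrow> ('a \<Rightarrow> real) \<Rightarrow> real \<Rightarrow> ('w \<Rightarrow> 'a) \<Rightarrow> bool" where
  "nearly_critical P \<phi> \<psi> \<epsilon> X \<longleftrightarrow>
     prob_space P \<and> X \<in> borel_measurable P \<and>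
     (\<exists>V X' X''.
        V \<in> borel_measurable P \<and> X' \<in> borel_measurable P \<and> X'' \<in> borel_measurable P \<and>
        (AE \<omega> in P. V \<omega> \<in> {a - b | a b. a \<in> subdifferential \<phi> (X' \<omega>) \<and>
                                      b \<in> subdifferential \<psi> (X'' \<omega>)}) \<and>
        max (\<integral>\<^sup>+\<omega>. ennreal (norm (V \<omega>)) \<partial>P)
          (max (\<integral>\<^sup>+\<omega>. ennreal (norm (X \<omega> - X' \<omega>)) \<partial>P)
               (\<integral>\<^sup>+\<omega>. ennreal (norm (X \<omega> - X'' \<omega>)) \<partial>P)) \<le> ennreal \<epsilon>)"

text \<open>The probability space carrying, in addition to \<open>P\<close>, an independent index that is uniform
  on \<open>{1..T}\<close>.\<close>

definition with_uniform_index :: "'w measure \<Rightarrow> nat \<Rightarrow> ('w \<times> nat) measure" where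
  "with_uniform_index P T = P \<Otimes>\<^sub>M uniform_count_measure {1..T}"

end

theory Submission
  imports Defs
begin

text \<open>
  SMAG is inexact gradient descent on the difference \<open>F\<gamma>\<close> of two Moreau envelopes. The gradient of
  \<open>F\<gamma>\<close> at a centre \<open>x\<close> is \<open>(prox\<^sub>\<psi> x - prox\<^sub>\<phi> x)/\<gamma>\<close>. The proximal points are not available, but each of
  them minimizes a function that is strongly convex with modulus \<open>1/\<gamma> - \<delta> \<ge> 2 \<alpha>\<close>, and \<open>x\<phi>\<close>, \<open>x\<psi>\<close> follow
  them by a single stochastic subgradient step per iteration. This suffices because the centre moves more
  slowly, by the factor \<open>\<tau>\<close>, than the inner iterates contract.

  Let \<open>D\<^sub>t\<close> be the sum of the two mean squared tracking errors and \<open>G\<^sub>t\<close> the direction actually used in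
  iteration \<open>t\<close>. Two inequalities carry the proof. The descent inequality (\<open>envelope_descent\<close>)
    \<open>E F\<gamma>(x\<^bsub>t+1\<^esub>) \<le> E F\<gamma>(x\<^sub>t) - \<eta>\<^sub>0/2 E norm (\<nabla>F\<gamma>(x\<^sub>t))\<^sup>2 - \<eta>\<^sub>0/8 E norm G\<^sub>t\<^sup>2 + \<eta>\<^sub>0/\<gamma>\<^sup>2 D\<^sub>t\<close>
  follows from quadratic upper and lower bounds for the envelopes. The tracking inequality
  (\<open>prox_tracking_step\<close>, once for each function)
    \<open>D\<^bsub>t+1\<^esub> \<le> (1 - 2 \<eta>\<^sub>1 \<alpha>) D\<^sub>t + \<eta>\<^sub>0/(8 \<alpha>) E norm G\<^sub>t\<^sup>2 + 8 \<eta>\<^sub>1\<^sup>2 M\<^sup>2\<close>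
  combines the contraction of a stochastic step (\<open>prox_sgd_step\<close>) with the Lipschitz continuity of the
  proximal map. Each inequality contains an error controlled by the other one, and the potential
  \<open>E F\<gamma>(x\<^sub>t) + \<alpha>/2 D\<^sub>t\<close> balances them (\<open>lyapunov_sum_bound\<close>). Its initial value exceeds \<open>Fstar\<close> by
  \<open>F\<gamma> x0 - Fstar + P\<^sub>0\<close>, and the prescribed step size and horizon turn the telescoped sum into the bound on
  the average (\<open>step_size_and_horizon_suffice\<close>).

  Near criticality is read off from that average (\<open>nearly_critical_uniform_index\<close>): \<open>\<nabla>F\<gamma>(x)\<close> is itself a
  difference of subgradients of \<open>\<phi>\<close> and \<open>\<psi>\<close> at the two proximal points, whose distance is
  \<open>\<gamma> norm (\<nabla>F\<gamma>(x))\<close>.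

  Weak convexity and one bounded subgradient at every point give all the regularity this needs: the
  subgradient inequality holds globally up to \<open>\<delta>/2 norm (y - x)\<^sup>2\<close>, all subgradients are bounded by \<open>M\<close>, and
  hence the gradients of the envelopes are bounded and all expectations are finite.
\<close>

section \<open>Subgradients of weakly convex functions\<close>

text \<open>A quadratic error is \<open>o(norm (y - x))\<close>, so a global minorant with such an error already
  certifies a subgradient. This is how the optimality condition of a proximal point enters.\<close>

lemma subdifferentialI_quadratic:
  fixes f :: "'a::euclidean_space \<Rightarrow> real"
  assumes "\<And>y. f y \<ge> f x + inner v (y - x) - K * (norm (y - x))\<^sup>2"
  shows "v \<in> subdifferential f x"
proof -
  let ?r = "\<lambda>y. - K * (norm (y - x))\<^sup>2"
  have "((\<lambda>y. - K * norm (y - x)) \<longlongrightarrow> - K * norm (x - x)) (at x)"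
    by (intro tendsto_intros)
  then have lim: "((\<lambda>y. - K * norm (y - x)) \<longlongrightarrow> 0) (at x)" by simp
  have ev: "\<forall>\<^sub>F y in at x. ?r y / norm (y - x) = - K * norm (y - x)"
    by (rule eventually_at_filter[THEN iffD2]) (auto simp: power2_eq_square)
  have "?r \<in> o[at x](\<lambda>y. norm (y - x))"
  proof (rule smalloI_tendsto)
    show "((\<lambda>y. ?r y / norm (y - x)) \<longlongrightarrow> 0) (at x)"
      using tendsto_cong[OF ev] lim by blast
    show "\<forall>\<^sub>F y in at x. norm (y - x) \<noteq> 0"
      by (rule eventually_at_filter[THEN iffD2]) auto
  qed
  moreover have "\<forall>\<^sub>F y in at x. f y \<ge> f x + inner v (y - x) + ?r y"
    using assms by (intro always_eventually allI) (simp add: algebra_simps)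
  ultimately show ?thesis unfolding subdifferential_def by blast
qed

lemma norm_add_sq:
  fixes x y :: "'a::real_inner"
  shows "(norm (x + y))\<^sup>2 = (norm x)\<^sup>2 + 2 * inner x y + (norm y)\<^sup>2"
  by (simp add: power2_norm_eq_inner inner_add_left inner_add_right inner_commute)

lemma norm_diff_sq:
  fixes x y :: "'a::real_inner"
  shows "(norm (x - y))\<^sup>2 = (norm x)\<^sup>2 - 2 * inner x y + (norm y)\<^sup>2"
  by (simp add: power2_norm_eq_inner inner_diff_left inner_diff_right inner_commute)

text \<open>Convexity of \<open>f + \<delta>/2 norm\<^sup>2\<close> turns the infinitesimal subgradient inequality into a global one.
  Write the little-o inequality at \<open>x + s (y - x)\<close>, bound the left-hand side by the chord of the convex
  function, divide by \<open>s\<close>, and let \<open>s\<close> tend to \<open>0\<close> from the right.\<close>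

lemma weakly_convex_subgradient_ineq:
  fixes f :: "'a::euclidean_space \<Rightarrow> real"
  assumes wc: "weakly_convex \<delta> f" and v: "v \<in> subdifferential f x"
  shows "f y \<ge> f x + inner v (y - x) - \<delta> / 2 * (norm (y - x))\<^sup>2"
proof (cases "y = x")
  case False
  define d where "d = y - x"
  have d: "norm d > 0" using False by (simp add: d_def)
  obtain r where r: "r \<in> o[at x](\<lambda>y. norm (y - x))"
    and sub: "\<forall>\<^sub>F y in at x. f y \<ge> f x + inner v (y - x) + r y"
    using v unfolding subdifferential_def by blast
  let ?p = "\<lambda>s::real. x + s *\<^sub>R d"
  have p: "filterlim ?p (at x) (at_right 0)"
  proof (rule filterlim_atI)
    have "((\<lambda>s. x + s *\<^sub>R d) \<longlongrightarrow> x + 0 *\<^sub>R d) (at_right 0)"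
      by (intro tendsto_intros)
    then show "(?p \<longlongrightarrow> x) (at_right 0)" by simp
    show "\<forall>\<^sub>F s in at_right 0. ?p s \<noteq> x"
      by (rule eventually_at_filter[THEN iffD2]) (use d in auto)
  qed
  have "((\<lambda>y. r y / norm (y - x)) \<longlongrightarrow> 0) (at x)" by (rule smalloD_tendsto[OF r])
  then have "((\<lambda>s. r (?p s) / norm (?p s - x)) \<longlongrightarrow> 0) (at_right 0)"
    by (rule filterlim_compose[OF _ p])
  then have "((\<lambda>s. norm d * (r (?p s) / norm (?p s - x))) \<longlongrightarrow> norm d * 0) (at_right 0)"
    by (intro tendsto_intros)
  then have lim0: "((\<lambda>s. norm d * (r (?p s) / norm (?p s - x))) \<longlongrightarrow> 0) (at_right 0)" by simp
  have "\<forall>\<^sub>F s in at_right 0. norm d * (r (?p s) / norm (?p s - x)) = r (?p s) / s"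
    by (rule eventually_at_right_less[THEN eventually_mono]) (use d in auto)
  then have rs: "((\<lambda>s. r (?p s) / s) \<longlongrightarrow> 0) (at_right 0)"
    by (rule Lim_transform_eventually[OF lim0])
  let ?q = "\<lambda>s. inner v d + r (?p s) / s + \<delta> * inner x d + \<delta> / 2 * s * (norm d)\<^sup>2"
  have "(?q \<longlongrightarrow> inner v d + 0 + \<delta> * inner x d + \<delta> / 2 * 0 * (norm d)\<^sup>2) (at_right 0)"
    by (intro tendsto_intros rs)
  then have lim: "(?q \<longlongrightarrow> inner v d + \<delta> * inner x d) (at_right 0)" by simp
  let ?h = "\<lambda>z. f z + \<delta> / 2 * (norm z)\<^sup>2"
  have "\<forall>\<^sub>F s in at_right 0. f (?p s) \<ge> f x + inner v (?p s - x) + r (?p s)"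
    using eventually_compose_filterlim[OF sub p] .
  moreover have "\<forall>\<^sub>F s in at_right (0::real). s < 1"
    by (rule eventually_at_rightI[of 0 1]) auto
  moreover have "\<forall>\<^sub>F s in at_right (0::real). 0 < s"
    by (rule eventually_at_right_less)
  ultimately have ev: "\<forall>\<^sub>F s in at_right 0. ?q s \<le> ?h y - ?h x"
  proof eventually_elim
    case (elim s)
    have "?h ((1 - s) *\<^sub>R x + s *\<^sub>R y) \<le> (1 - s) * ?h x + s * ?h y"
      using wc elim by (intro convex_onD[where A=UNIV]) (auto simp: weakly_convex_def)
    moreover have "(1 - s) *\<^sub>R x + s *\<^sub>R y = ?p s" by (simp add: d_def algebra_simps)
    ultimately have "?h (?p s) \<le> (1 - s) * ?h x + s * ?h y" by simp
    moreover have "(1 - s) * ?h x + s * ?h y = ?h x + s * (?h y - ?h x)" by (simp add: field_simps)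
    ultimately have "?h (?p s) - ?h x \<le> s * (?h y - ?h x)" by linarith
    moreover have "(norm (?p s))\<^sup>2 = (norm x)\<^sup>2 + 2 * s * inner x d + s\<^sup>2 * (norm d)\<^sup>2"
      by (simp add: norm_add_sq power_mult_distrib)
    moreover have "f (?p s) \<ge> f x + s * inner v d + r (?p s)" using elim by simp
    ultimately have "s * inner v d + r (?p s) + \<delta> / 2 * (2 * s * inner x d + s\<^sup>2 * (norm d)\<^sup>2)
        \<le> s * (?h y - ?h x)" by (simp add: algebra_simps)
    moreover have "s * inner v d + r (?p s) + \<delta> / 2 * (2 * s * inner x d + s\<^sup>2 * (norm d)\<^sup>2) = s * ?q s"
      using elim by (simp add: field_simps power2_eq_square)
    ultimately show ?case using elim by simp
  qed
  have "inner v d + \<delta> * inner x d \<le> ?h y - ?h x"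
    by (rule tendsto_upperbound[OF lim ev]) simp
  moreover have "(norm y)\<^sup>2 = (norm x)\<^sup>2 + 2 * inner x d + (norm d)\<^sup>2"
    using norm_add_sq[of x d] by (simp add: d_def)
  ultimately show ?thesis unfolding d_def[symmetric] by (simp add: algebra_simps)
qed simp

text \<open>Add the two subgradient inequalities at \<open>x\<close> and \<open>y\<close>.\<close>

lemma weakly_convex_hypomonotone:
  fixes f :: "'a::euclidean_space \<Rightarrow> real"
  assumes wc: "weakly_convex \<delta> f"
    and v: "v \<in> subdifferential f x" and w: "w \<in> subdifferential f y"
  shows "inner (v - w) (x - y) \<ge> - \<delta> * (norm (x - y))\<^sup>2"
  using weakly_convex_subgradient_ineq[OF wc v, of y] weakly_convex_subgradient_ineq[OF wc w, of x]
  by (simp add: algebra_simps norm_minus_commute[of y x] inner_diff_left inner_diff_right)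

lemma weakly_convex_continuous:
  fixes f :: "'a::euclidean_space \<Rightarrow> real"
  assumes "weakly_convex \<delta> f"
  shows "continuous_on UNIV f"
proof -
  have "continuous_on UNIV (\<lambda>x. f x + \<delta> / 2 * (norm x)\<^sup>2)"
    using assms by (intro convex_on_continuous) (auto simp: weakly_convex_def)
  then have "continuous_on UNIV (\<lambda>x. (f x + \<delta> / 2 * (norm x)\<^sup>2) - \<delta> / 2 * (norm x)\<^sup>2)"
    by (rule continuous_on_diff) (intro continuous_intros)
  then show ?thesis by simp
qed

text \<open>A single bounded subgradient at every point makes \<open>f\<close> Lipschitz, so all subgradients obey the
  same bound: compare \<open>w\<close> with a bounded subgradient \<open>v\<close> at the point \<open>x + s w\<close>, slightly ahead in
  the direction of \<open>w\<close>. Hypomonotonicity gives \<open>norm w - M \<le> \<delta> s norm w\<close> for every \<open>s > 0\<close>.\<close>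

lemma subgradient_norm_le:
  fixes f :: "'a::euclidean_space \<Rightarrow> real"
  assumes wc: "weakly_convex \<delta> f"
    and sel: "\<And>z. \<exists>v\<in>subdifferential f z. norm v \<le> M"
    and w: "w \<in> subdifferential f x"
  shows "norm w \<le> M"
proof (rule ccontr)
  assume "\<not> norm w \<le> M"
  then have gt: "norm w > M" by simp
  obtain v0 where "v0 \<in> subdifferential f x" "norm v0 \<le> M" using sel by blast
  then have "M \<ge> 0" using norm_ge_zero order_trans by blast
  then have w0: "norm w > 0" using gt by linarith
  \<comment> \<open>This choice turns \<open>norm w - M \<le> \<delta> s norm w\<close> into \<open>norm w - M \<le> (norm w - M)/2\<close>.\<close>
  define s where "s = (norm w - M) / (2 * (\<bar>\<delta>\<bar> + 1) * norm w)"
  have s: "s > 0" using gt w0 unfolding s_def by (simp add: add_nonneg_pos)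
  obtain v where v: "v \<in> subdifferential f (x + s *\<^sub>R w)" "norm v \<le> M" using sel by blast
  have "- \<delta> * (s * norm w)\<^sup>2 \<le> inner (v - w) (s *\<^sub>R w)"
    using weakly_convex_hypomonotone[OF wc v(1) w] s by (simp add: power_mult_distrib)
  also have "\<dots> = s * (inner v w - (norm w)\<^sup>2)"
    by (simp add: inner_diff_left power2_norm_eq_inner)
  also have "\<dots> \<le> s * (M * norm w - (norm w)\<^sup>2)"
    using s v(2) norm_cauchy_schwarz[of v w] mult_right_mono[OF v(2), of "norm w"]
    by (intro mult_left_mono) auto
  finally have "s * norm w * (norm w - M) \<le> s * norm w * (\<delta> * s * norm w)"
    by (simp add: algebra_simps power2_eq_square)
  then have "norm w - M \<le> \<delta> * s * norm w" using s w0 by simp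
  also have "\<dots> \<le> (\<bar>\<delta>\<bar> + 1) * s * norm w"
    using s w0 by (intro mult_right_mono) auto
  also have "\<dots> = (norm w - M) / 2"
    using w0 unfolding s_def by (simp add: field_simps add_nonneg_eq_0_iff)
  finally show False using gt by simp
qed

section \<open>Proximal points and Moreau envelopes\<close>

text \<open>The analytic data attached to one of the two functions. Bounded subgradients are only required
  of a selection, because that is what an unbiased oracle with bounded second moment provides.\<close>

locale weakly_convex_lipschitz =
  fixes f :: "'a::euclidean_space \<Rightarrow> real" and \<delta> \<gamma> M :: real
  assumes weakly_convex: "weakly_convex \<delta> f"
    and \<delta>_nonneg: "\<delta> \<ge> 0"
    and \<gamma>_pos: "\<gamma> > 0"
    and \<gamma>_less: "\<gamma> * \<delta> < 1"
    and bounded_selection: "\<exists>v\<in>subdifferential f z. norm v \<le> M"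
begin

text \<open>A strong convexity modulus of the proximal objective.\<close>

definition prox_modulus :: real (\<open>\<mu>\<close>) where
  "\<mu> = 1 / \<gamma> - \<delta>"

text \<open>It is both the gradient of the Moreau envelope at \<open>x\<close> and a subgradient of \<open>f\<close> at the proximal
  point; the second fact bounds it by \<open>M\<close>.\<close>

definition moreau_gradient :: "'a \<Rightarrow> 'a" where
  "moreau_gradient x = (1 / \<gamma>) *\<^sub>R (x - prox \<gamma> f x)"

abbreviation prox_objective :: "'a \<Rightarrow> 'a \<Rightarrow> real" where
  "prox_objective x z \<equiv> f z + 1 / (2 * \<gamma>) * (norm (z - x))\<^sup>2"

lemma \<mu>_pos: "\<mu> > 0"
  using \<gamma>_pos \<gamma>_less by (simp add: prox_modulus_def field_simps)

lemma \<gamma>\<mu>: "\<gamma> * \<mu> = 1 - \<gamma> * \<delta>"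
  using \<gamma>_pos by (simp add: prox_modulus_def field_simps)

lemma \<gamma>\<mu>_le_1: "\<gamma> * \<mu> \<le> 1"
  using \<gamma>_pos \<delta>_nonneg by (simp add: \<gamma>\<mu>)

lemma M_nonneg: "M \<ge> 0"
  using bounded_selection[of 0] norm_ge_zero order_trans by blast

text \<open>Existence of the minimum: outside a ball around \<open>x\<close> the quadratic growth with modulus \<open>\<mu>\<close> beats
  the linear lower bound given by a subgradient at \<open>x\<close>, and inside the ball continuity suffices.
  Every property below is derived for whichever minimizer \<^const>\<open>prox\<close> selects.\<close>

lemma prox_objective_minimal: "prox_objective x (prox \<gamma> f x) \<le> prox_objective x z"
proof -
  obtain v where v: "v \<in> subdifferential f x" "norm v \<le> M" using bounded_selection by blast
  \<comment> \<open>Beyond this radius the quadratic \<open>\<mu>/2 r\<^sup>2\<close> exceeds the linear term \<open>M r\<close>.\<close>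
  define R where "R = 2 * M / \<mu> + 1"
  have R: "R > 0" using M_nonneg \<mu>_pos by (simp add: R_def add_nonneg_pos)
  have far: "prox_objective x x \<le> prox_objective x z" if "norm (z - x) > R" for z
  proof -
    have n: "norm (z - x) > 0" using that R by linarith
    have "- inner v (z - x) \<le> M * norm (z - x)"
      using norm_cauchy_schwarz[of "-v" "z - x"] v(2) mult_right_mono[OF v(2), of "norm (z - x)"]
      by auto
    moreover have "\<mu> / 2 * norm (z - x) \<ge> M"
      using that \<mu>_pos unfolding R_def by (simp add: field_simps)
    then have "(\<mu> / 2 * norm (z - x)) * norm (z - x) \<ge> M * norm (z - x)"
      using n by (intro mult_right_mono) auto
    then have "\<mu> / 2 * (norm (z - x))\<^sup>2 \<ge> M * norm (z - x)"
      by (simp add: power2_eq_square)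
    moreover have "\<mu> / 2 * (norm (z - x))\<^sup>2
        = 1 / (2 * \<gamma>) * (norm (z - x))\<^sup>2 - \<delta> / 2 * (norm (z - x))\<^sup>2"
      using \<gamma>_pos by (simp add: prox_modulus_def field_simps)
    ultimately show ?thesis
      using weakly_convex_subgradient_ineq[OF weakly_convex v(1), of z] by simp
  qed
  have "continuous_on (cball x R) (prox_objective x)"
    using continuous_on_subset[OF weakly_convex_continuous[OF weakly_convex]]
    by (intro continuous_intros) auto
  then obtain p where p: "p \<in> cball x R" "\<And>y. y \<in> cball x R \<Longrightarrow> prox_objective x p \<le> prox_objective x y"
    using continuous_attains_inf[of "cball x R" "prox_objective x"] R by auto
  have min: "prox_objective x p \<le> prox_objective x z" for z
  proof (cases "norm (z - x) > R")
    case True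
    then show ?thesis using far[OF True] p(2)[of x] R by simp
  next
    case False
    then show ?thesis using p(2)[of z] by (simp add: dist_norm norm_minus_commute)
  qed
  have "prox_objective x (prox \<gamma> f x) = prox_objective x p"
    unfolding prox_def by (rule arg_min_equality) (use min in auto)
  then show ?thesis using min by simp
qed

lemma moreau_eq: "moreau \<gamma> f x = prox_objective x (prox \<gamma> f x)"
  unfolding moreau_def
proof (rule antisym)
  have "bdd_below (range (prox_objective x))"
    using prox_objective_minimal by (rule bdd_belowI2)
  then show "(INF z. prox_objective x z) \<le> prox_objective x (prox \<gamma> f x)"
    by (rule cINF_lower) simp
  show "prox_objective x (prox \<gamma> f x) \<le> (INF z. prox_objective x z)"
    using prox_objective_minimal by (intro cINF_greatest) auto
qed

lemma inner_moreau_gradient: "inner (moreau_gradient x) u = inner (x - prox \<gamma> f x) u / \<gamma>"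
  by (simp add: moreau_gradient_def)

text \<open>Expand the square around the proximal point in the minimality of that point; the remaining
  error is quadratic.\<close>

lemma moreau_gradient_subgradient: "moreau_gradient x \<in> subdifferential f (prox \<gamma> f x)"
proof (rule subdifferentialI_quadratic)
  fix z
  let ?p = "prox \<gamma> f x"
  have "(norm (z - x))\<^sup>2 = (norm (?p - x))\<^sup>2 - 2 * inner (x - ?p) (z - ?p) + (norm (z - ?p))\<^sup>2"
    using norm_add_sq[of "?p - x" "z - ?p"]
    by (simp add: inner_diff_left inner_diff_right algebra_simps)
  then have "1 / (2 * \<gamma>) * (norm (z - x))\<^sup>2 = 1 / (2 * \<gamma>) * (norm (?p - x))\<^sup>2
      - inner (moreau_gradient x) (z - ?p) + 1 / (2 * \<gamma>) * (norm (z - ?p))\<^sup>2"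
    using \<gamma>_pos unfolding inner_moreau_gradient by (simp add: field_simps)
  then show "f ?p + inner (moreau_gradient x) (z - ?p) - 1 / (2 * \<gamma>) * (norm (z - ?p))\<^sup>2 \<le> f z"
    using prox_objective_minimal[of x z] by linarith
qed

lemma norm_moreau_gradient_le: "norm (moreau_gradient x) \<le> M"
  using subgradient_norm_le[OF weakly_convex bounded_selection moreau_gradient_subgradient] .

text \<open>Hypomonotonicity for the subgradients \<open>(x - prox x)/\<gamma>\<close> at the two proximal points.\<close>

lemma prox_lipschitz: "norm (prox \<gamma> f x - prox \<gamma> f y) \<le> 1 / (\<gamma> * \<mu>) * norm (x - y)"
proof -
  let ?d = "prox \<gamma> f x - prox \<gamma> f y"
  have "moreau_gradient x - moreau_gradient y = (1 / \<gamma>) *\<^sub>R ((x - y) - ?d)"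
    by (simp add: moreau_gradient_def scaleR_diff_right)
  then have "- \<delta> * (norm ?d)\<^sup>2 \<le> 1 / \<gamma> * (inner (x - y) ?d - (norm ?d)\<^sup>2)"
    using weakly_convex_hypomonotone[OF weakly_convex moreau_gradient_subgradient
        moreau_gradient_subgradient, of x y]
    by (simp add: inner_diff_left power2_norm_eq_inner)
  then have "\<gamma> * \<mu> * (norm ?d)\<^sup>2 \<le> inner (x - y) ?d"
    using \<gamma>_pos unfolding \<gamma>\<mu> by (simp add: field_simps)
  also have "\<dots> \<le> norm (x - y) * norm ?d" by (rule norm_cauchy_schwarz)
  finally have "norm ?d * (\<gamma> * \<mu> * norm ?d) \<le> norm ?d * norm (x - y)"
    by (simp add: power2_eq_square algebra_simps)
  then have "\<gamma> * \<mu> * norm ?d \<le> norm (x - y)"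
    by (cases "norm ?d = 0") (auto dest: mult_left_le_imp_le)
  then show ?thesis using \<gamma>_pos \<mu>_pos by (simp add: field_simps)
qed

lemma moreau_gradient_lipschitz:
  "norm (moreau_gradient x - moreau_gradient y) \<le> 2 / (\<gamma>\<^sup>2 * \<mu>) * norm (x - y)"
proof -
  let ?d = "prox \<gamma> f x - prox \<gamma> f y"
  have le: "norm (x - y) \<le> 1 / (\<gamma> * \<mu>) * norm (x - y)"
    using mult_right_mono[OF \<gamma>\<mu>_le_1, of "norm (x - y)"] \<gamma>_pos \<mu>_pos by (simp add: field_simps)
  have "moreau_gradient x - moreau_gradient y = (1 / \<gamma>) *\<^sub>R ((x - y) - ?d)"
    by (simp add: moreau_gradient_def scaleR_diff_right)
  then have "norm (moreau_gradient x - moreau_gradient y) \<le> 1 / \<gamma> * (norm (x - y) + norm ?d)"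
    using \<gamma>_pos norm_triangle_ineq4[of "x - y" ?d] by (simp add: divide_right_mono)
  also have "\<dots> \<le> 1 / \<gamma> * (1 / (\<gamma> * \<mu>) * norm (x - y) + 1 / (\<gamma> * \<mu>) * norm (x - y))"
    using prox_lipschitz[of x y] \<gamma>_pos le by (intro mult_left_mono add_mono) auto
  also have "\<dots> = 2 / (\<gamma>\<^sup>2 * \<mu>) * norm (x - y)"
    by (simp add: power2_eq_square)
  finally show ?thesis .
qed

lemma continuous_prox: "continuous_on UNIV (prox \<gamma> f)"
proof (rule lipschitz_on_continuous_on)
  show "(1 / (\<gamma> * \<mu>))-lipschitz_on UNIV (prox \<gamma> f)"
    using prox_lipschitz \<gamma>_pos \<mu>_pos by (intro lipschitz_onI) (auto simp: dist_norm)
qed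

text \<open>Use the proximal point of \<open>x\<close> as a competitor in the minimization that defines the envelope
  at \<open>y\<close>.\<close>

lemma moreau_upper:
  "moreau \<gamma> f y \<le> moreau \<gamma> f x + inner (moreau_gradient x) (y - x) + 1 / (2 * \<gamma>) * (norm (y - x))\<^sup>2"
proof -
  let ?p = "prox \<gamma> f x"
  have "(norm (?p - y))\<^sup>2 = (norm (?p - x))\<^sup>2 + 2 * inner (x - ?p) (y - x) + (norm (y - x))\<^sup>2"
    using norm_diff_sq[of "?p - x" "y - x"]
    by (simp add: inner_diff_left inner_diff_right algebra_simps)
  then have "1 / (2 * \<gamma>) * (norm (?p - y))\<^sup>2 = 1 / (2 * \<gamma>) * (norm (?p - x))\<^sup>2
      + inner (moreau_gradient x) (y - x) + 1 / (2 * \<gamma>) * (norm (y - x))\<^sup>2"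
    using \<gamma>_pos unfolding inner_moreau_gradient by (simp add: field_simps)
  then show ?thesis
    using prox_objective_minimal[of y ?p] by (simp add: moreau_eq)
qed

text \<open>Exchange the roles of \<open>x\<close> and \<open>y\<close> in the upper bound and pay for moving the gradient from
  \<open>y\<close> back to \<open>x\<close> with its Lipschitz constant. The constant is not sharp; the step sizes leave room for it.\<close>

lemma moreau_lower:
  "moreau \<gamma> f y \<ge> moreau \<gamma> f x + inner (moreau_gradient x) (y - x)
     - 5 / (2 * \<gamma>\<^sup>2 * \<mu>) * (norm (y - x))\<^sup>2"
proof -
  have "inner (moreau_gradient x - moreau_gradient y) (y - x)
      \<le> 2 / (\<gamma>\<^sup>2 * \<mu>) * norm (y - x) * norm (y - x)"
    using norm_cauchy_schwarz[of "moreau_gradient x - moreau_gradient y" "y - x"]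
      mult_right_mono[OF moreau_gradient_lipschitz[of x y], of "norm (y - x)"]
    by (simp add: norm_minus_commute)
  moreover have "1 / (2 * \<gamma>) \<le> 1 / (2 * \<gamma>\<^sup>2 * \<mu>)"
  proof -
    have "2 * \<gamma>\<^sup>2 * \<mu> = 2 * \<gamma> * (\<gamma> * \<mu>)" by (simp add: power2_eq_square)
    also have "\<dots> \<le> 2 * \<gamma> * 1" using \<gamma>\<mu>_le_1 \<gamma>_pos by (intro mult_left_mono) auto
    finally show ?thesis using \<gamma>_pos \<mu>_pos by (intro divide_left_mono) auto
  qed
  then have "1 / (2 * \<gamma>) * (norm (y - x))\<^sup>2 \<le> 1 / (2 * \<gamma>\<^sup>2 * \<mu>) * (norm (y - x))\<^sup>2"
    by (intro mult_right_mono) auto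
  moreover have "5 / (2 * \<gamma>\<^sup>2 * \<mu>) * (norm (y - x))\<^sup>2
      = 2 / (\<gamma>\<^sup>2 * \<mu>) * norm (y - x) * norm (y - x) + 1 / (2 * \<gamma>\<^sup>2 * \<mu>) * (norm (y - x))\<^sup>2"
    using \<gamma>_pos \<mu>_pos by (simp add: field_simps power2_eq_square)
  ultimately show ?thesis
    using moreau_upper[of x y]
    by (simp add: inner_diff_left inner_diff_right norm_minus_commute[of x y] algebra_simps)
qed

lemma moreau_gderiv: "GDERIV (moreau \<gamma> f) x :> moreau_gradient x"
  unfolding gderiv_def
proof (rule has_derivativeI_sandwich[where e = 1])
  define K where "K = 1 / (2 * \<gamma>) + 5 / (2 * \<gamma>\<^sup>2 * \<mu>)"
  show "bounded_linear (\<lambda>h. inner h (moreau_gradient x))" by (rule bounded_linear_inner_left)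
  have "((\<lambda>y. K * norm (y - x)) \<longlongrightarrow> K * norm (x - x)) (at x)" by (intro tendsto_intros)
  then show "((\<lambda>y. K * norm (y - x)) \<longlongrightarrow> 0) (at x)" by simp
  fix y assume "y \<noteq> x"
  have "1 / (2 * \<gamma>) * (norm (y - x))\<^sup>2 \<ge> 0" "5 / (2 * \<gamma>\<^sup>2 * \<mu>) * (norm (y - x))\<^sup>2 \<ge> 0"
    using \<gamma>_pos \<mu>_pos by auto
  then have "\<bar>moreau \<gamma> f y - moreau \<gamma> f x - inner (moreau_gradient x) (y - x)\<bar> \<le> K * (norm (y - x))\<^sup>2"
    using moreau_upper[of y x] moreau_lower[of x y] unfolding K_def distrib_right by linarith
  then show "norm (moreau \<gamma> f y - moreau \<gamma> f x - inner (y - x) (moreau_gradient x)) / norm (y - x)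
      \<le> K * norm (y - x)"
    using \<open>y \<noteq> x\<close> by (simp add: field_simps power2_eq_square inner_commute)
qed simp

end

section \<open>Square-integrable random vectors\<close>

definition square_integrable :: "'w measure \<Rightarrow> ('w \<Rightarrow> 'a::euclidean_space) \<Rightarrow> bool" where
  "square_integrable P X \<longleftrightarrow> X \<in> borel_measurable P \<and> integrable P (\<lambda>\<omega>. (norm (X \<omega>))\<^sup>2)"

text \<open>Domination: all closure properties of \<open>L\<^sup>2\<close> below are instances.\<close>

lemma square_integrable_bound:
  assumes "square_integrable P X" "square_integrable P Y" "Z \<in> borel_measurable P"
    and "\<And>\<omega>. \<omega> \<in> space P \<Longrightarrow> (norm (Z \<omega>))\<^sup>2 \<le> c * ((norm (X \<omega>))\<^sup>2 + (norm (Y \<omega>))\<^sup>2)"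
  shows "square_integrable P Z"
  unfolding square_integrable_def
proof (intro conjI)
  show "integrable P (\<lambda>\<omega>. (norm (Z \<omega>))\<^sup>2)"
  proof (rule Bochner_Integration.integrable_bound)
    show "integrable P (\<lambda>\<omega>. c * ((norm (X \<omega>))\<^sup>2 + (norm (Y \<omega>))\<^sup>2))"
      using assms by (intro integrable_mult_right Bochner_Integration.integrable_add)
        (auto simp: square_integrable_def)
    show "AE \<omega> in P. norm ((norm (Z \<omega>))\<^sup>2) \<le> norm (c * ((norm (X \<omega>))\<^sup>2 + (norm (Y \<omega>))\<^sup>2))"
      using assms(4) by (intro AE_I2) (smt (verit) norm_power real_norm_def zero_le_power2)
  qed (use assms(3) in measurable)
qed fact

lemma norm_add_sq_le:
  fixes x y :: "'a::real_inner"
  shows "(norm (x + y))\<^sup>2 \<le> 2 * ((norm x)\<^sup>2 + (norm y)\<^sup>2)"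
proof -
  have "0 \<le> (norm x)\<^sup>2 - 2 * inner x y + (norm y)\<^sup>2"
    unfolding norm_diff_sq[symmetric] by simp
  then show ?thesis by (simp add: norm_add_sq)
qed

lemma norm_diff_sq_le:
  fixes x y :: "'a::real_inner"
  shows "(norm (x - y))\<^sup>2 \<le> 2 * ((norm x)\<^sup>2 + (norm y)\<^sup>2)"
  using norm_add_sq_le[of x "- y"] by simp

lemma square_integrable_measurable:
  "square_integrable P X \<Longrightarrow> X \<in> borel_measurable P"
  by (simp add: square_integrable_def)

lemma square_integrable_diff:
  assumes "square_integrable P X" "square_integrable P Y"
  shows "square_integrable P (\<lambda>\<omega>. X \<omega> - Y \<omega>)"
  using assms
  by (rule square_integrable_bound[where c = 2])
    (use assms norm_diff_sq_le in \<open>auto simp: square_integrable_def\<close>)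

lemma square_integrable_add:
  assumes "square_integrable P X" "square_integrable P Y"
  shows "square_integrable P (\<lambda>\<omega>. X \<omega> + Y \<omega>)"
  using assms
  by (rule square_integrable_bound[where c = 2])
    (use assms norm_add_sq_le in \<open>auto simp: square_integrable_def\<close>)

lemma square_integrable_scaleR:
  assumes "square_integrable P X"
  shows "square_integrable P (\<lambda>\<omega>. c *\<^sub>R X \<omega>)"
  using assms by (auto simp: square_integrable_def power_mult_distrib)

lemma (in finite_measure) square_integrable_bounded:
  assumes "X \<in> borel_measurable M" "\<And>\<omega>. \<omega> \<in> space M \<Longrightarrow> norm (X \<omega>) \<le> B"
  shows "square_integrable M X"
  unfolding square_integrable_def
proof
  show "integrable M (\<lambda>\<omega>. (norm (X \<omega>))\<^sup>2)"
    using assms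
    by (intro integrable_const_bound[where B = "B\<^sup>2"] AE_I2) (auto intro: power_mono)
qed fact

lemma square_integrable_cong:
  assumes "\<And>\<omega>. \<omega> \<in> space P \<Longrightarrow> X \<omega> = Y \<omega>"
  shows "square_integrable P X \<longleftrightarrow> square_integrable P Y"
  unfolding square_integrable_def using assms
  by (intro conj_cong measurable_cong Bochner_Integration.integrable_cong) auto

lemma square_integrable_inner:
  assumes "square_integrable P X" "square_integrable P Y"
  shows "integrable P (\<lambda>\<omega>. inner (X \<omega>) (Y \<omega>))"
proof (rule Bochner_Integration.integrable_bound)
  show "integrable P (\<lambda>\<omega>. (norm (X \<omega>))\<^sup>2 + (norm (Y \<omega>))\<^sup>2)"
    using assms by (intro Bochner_Integration.integrable_add) (auto simp: square_integrable_def)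
  show "(\<lambda>\<omega>. inner (X \<omega>) (Y \<omega>)) \<in> borel_measurable P"
    using assms by (intro borel_measurable_inner) (auto simp: square_integrable_def)
  show "AE \<omega> in P. norm (inner (X \<omega>) (Y \<omega>)) \<le> norm ((norm (X \<omega>))\<^sup>2 + (norm (Y \<omega>))\<^sup>2)"
  proof (intro AE_I2)
    fix \<omega>
    have "\<bar>inner (X \<omega>) (Y \<omega>)\<bar> \<le> norm (X \<omega>) * norm (Y \<omega>)" by (rule Cauchy_Schwarz_ineq2)
    also have "\<dots> \<le> 2 * (norm (X \<omega>) * norm (Y \<omega>))" by simp
    also have "\<dots> \<le> (norm (X \<omega>))\<^sup>2 + (norm (Y \<omega>))\<^sup>2"
      using sum_squares_bound[of "norm (X \<omega>)" "norm (Y \<omega>)"] by (simp add: mult.assoc)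
    finally show "norm (inner (X \<omega>) (Y \<omega>)) \<le> norm ((norm (X \<omega>))\<^sup>2 + (norm (Y \<omega>))\<^sup>2)" by simp
  qed
qed

lemma square_integrable_inner_Basis:
  assumes "square_integrable P X" "b \<in> Basis"
  shows "square_integrable P (\<lambda>\<omega>. inner (X \<omega>) b)"
proof (rule square_integrable_bound[OF assms(1) assms(1), where c = 1])
  show "(\<lambda>\<omega>. inner (X \<omega>) b) \<in> borel_measurable P"
    using assms(1) by (intro borel_measurable_inner) (auto simp: square_integrable_def)
  fix \<omega>
  have "(norm (inner (X \<omega>) b))\<^sup>2 \<le> (norm (X \<omega>))\<^sup>2"
    using Basis_le_norm[OF assms(2)] by (intro power_mono) auto
  then show "(norm (inner (X \<omega>) b))\<^sup>2 \<le> 1 * ((norm (X \<omega>))\<^sup>2 + (norm (X \<omega>))\<^sup>2)"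
    using zero_le_power2[of "norm (X \<omega>)"] unfolding mult_1 by linarith
qed

lemma square_integrable_norm_sq:
  "square_integrable P X \<Longrightarrow> integrable P (\<lambda>\<omega>. (norm (X \<omega>))\<^sup>2)"
  by (simp add: square_integrable_def)

section \<open>Stochastic subgradients\<close>

text \<open>The mean of the oracle is a subgradient, and its norm is at most \<open>M\<close> by Jensen's inequality, here
  in the elementary form \<open>r \<le> (r\<^sup>2/M + M)/2\<close>.\<close>

lemma subgradient_oracle_bounded_selection:
  assumes "prob_space D" "subgradient_oracle D f M g" "M > 0"
  shows "\<exists>v\<in>subdifferential f z. norm v \<le> M"
proof
  interpret prob_space D by fact
  show "(\<integral>s. g z s \<partial>D) \<in> subdifferential f z"
    using assms(2) by (simp add: subgradient_oracle_def)
  have g[measurable]: "g z \<in> borel_measurable D"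
    and le: "(\<integral>\<^sup>+s. ennreal ((norm (g z s))\<^sup>2) \<partial>D) \<le> ennreal (M\<^sup>2)"
    using assms(2) by (auto simp: subgradient_oracle_def)
  have int: "integrable D (\<lambda>s. (norm (g z s))\<^sup>2)"
    using le by (intro integrableI_bounded) (auto simp: le_less_trans)
  have "ennreal (\<integral>s. (norm (g z s))\<^sup>2 \<partial>D) \<le> ennreal (M\<^sup>2)"
    using nn_integral_eq_integral[OF int] le by simp
  then have sq: "(\<integral>s. (norm (g z s))\<^sup>2 \<partial>D) \<le> M\<^sup>2" by simp
  have "norm (\<integral>s. g z s \<partial>D) \<le> (\<integral>s. norm (g z s) \<partial>D)" by (rule integral_norm_bound)
  also have "\<dots> \<le> (\<integral>s. ((norm (g z s))\<^sup>2 / M + M) / 2 \<partial>D)"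
  proof (rule integral_mono')
    show "integrable D (\<lambda>s. ((norm (g z s))\<^sup>2 / M + M) / 2)" using int by simp
    show "norm (g z s) \<le> ((norm (g z s))\<^sup>2 / M + M) / 2" for s
      using assms(3) sum_squares_bound[of "norm (g z s)" M]
      by (simp add: field_simps power2_eq_square)
  qed (use assms(3) in \<open>auto intro!: add_nonneg_nonneg divide_nonneg_nonneg\<close>)
  also have "\<dots> = ((\<integral>s. (norm (g z s))\<^sup>2 \<partial>D) / M + M) / 2"
    using int by (simp add: prob_space)
  also have "\<dots> \<le> (M\<^sup>2 / M + M) / 2"
    using sq assms(3) by (intro divide_right_mono add_right_mono) auto
  finally show "norm (\<integral>s. g z s \<partial>D) \<le> M" using assms(3) by (simp add: power2_eq_square)
qed

text \<open>Integrate the conditional moment bound.\<close>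

lemma cond_subgradient_estimator_moment:
  assumes "prob_space P" "subalgebra P F" "cond_subgradient_estimator P F f M X G"
  shows "square_integrable P G" "(\<integral>\<omega>. (norm (G \<omega>))\<^sup>2 \<partial>P) \<le> M\<^sup>2"
proof -
  interpret prob_space P by fact
  interpret finite_measure_subalgebra P F by unfold_locales fact
  have [measurable]: "G \<in> borel_measurable P"
    and le: "AE \<omega> in P. nn_cond_exp P F (\<lambda>\<omega>'. ennreal ((norm (G \<omega>'))\<^sup>2)) \<omega> \<le> ennreal (M\<^sup>2)"
    using assms(3) by (auto simp: cond_subgradient_estimator_def)
  have "(\<integral>\<^sup>+\<omega>. ennreal ((norm (G \<omega>))\<^sup>2) \<partial>P)
      = (\<integral>\<^sup>+\<omega>. 1 * nn_cond_exp P F (\<lambda>\<omega>'. ennreal ((norm (G \<omega>'))\<^sup>2)) \<omega> \<partial>P)"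
    by (subst nn_cond_exp_intg) auto
  also have "\<dots> \<le> (\<integral>\<^sup>+\<omega>. ennreal (M\<^sup>2) \<partial>P)"
    using le by (intro nn_integral_mono_AE) auto
  also have "\<dots> = ennreal (M\<^sup>2)" by (simp add: emeasure_space_1)
  finally have bound: "(\<integral>\<^sup>+\<omega>. ennreal ((norm (G \<omega>))\<^sup>2) \<partial>P) \<le> ennreal (M\<^sup>2)" .
  then have int: "integrable P (\<lambda>\<omega>. (norm (G \<omega>))\<^sup>2)"
    by (intro integrableI_bounded) (auto simp: le_less_trans)
  then show "square_integrable P G" by (simp add: square_integrable_def)
  have "ennreal (\<integral>\<omega>. (norm (G \<omega>))\<^sup>2 \<partial>P) \<le> ennreal (M\<^sup>2)"
    using nn_integral_eq_integral[OF int] bound by simp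
  then show "(\<integral>\<omega>. (norm (G \<omega>))\<^sup>2 \<partial>P) \<le> M\<^sup>2" by simp
qed

text \<open>The defining property of conditional expectation, tested against an \<open>F\<close>-measurable vector and
  applied coordinate by coordinate.\<close>

lemma inner_vec_cond_exp:
  assumes "prob_space P" "subalgebra P F" "Z \<in> borel_measurable F"
    and "square_integrable P Z" "square_integrable P G"
  shows "integrable P (\<lambda>\<omega>. inner (Z \<omega>) (vec_cond_exp P F G \<omega>))"
    and "(\<integral>\<omega>. inner (Z \<omega>) (vec_cond_exp P F G \<omega>) \<partial>P) = (\<integral>\<omega>. inner (Z \<omega>) (G \<omega>) \<partial>P)"
proof -
  interpret prob_space P by fact
  interpret finite_measure_subalgebra P F by unfold_locales fact
  have [measurable]: "Z \<in> borel_measurable F" "G \<in> borel_measurable P"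
    using assms by (auto simp: square_integrable_def)
  have ZP[measurable]: "Z \<in> borel_measurable P"
    using assms(4) by (simp add: square_integrable_def)
  let ?g = "\<lambda>b \<omega>. real_cond_exp P F (\<lambda>\<omega>'. inner (G \<omega>') b) \<omega>"
  have int: "integrable P (\<lambda>\<omega>. inner (Z \<omega>) b * inner (G \<omega>) b)" if "b \<in> Basis" for b
  proof -
    have "square_integrable P (\<lambda>\<omega>. inner (Z \<omega>) b)"
      by (rule square_integrable_inner_Basis[OF assms(4) that])
    moreover have "square_integrable P (\<lambda>\<omega>. inner (G \<omega>) b)"
      by (rule square_integrable_inner_Basis[OF assms(5) that])
    ultimately show ?thesis using square_integrable_inner by fastforce
  qed
  have coord: "integrable P (\<lambda>\<omega>. inner (Z \<omega>) b * ?g b \<omega>)"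
      "(\<integral>\<omega>. inner (Z \<omega>) b * ?g b \<omega> \<partial>P) = (\<integral>\<omega>. inner (Z \<omega>) b * inner (G \<omega>) b \<partial>P)"
    if "b \<in> Basis" for b
    using real_cond_exp_intg[OF int[OF that]] by auto
  have eq: "inner (Z \<omega>) (vec_cond_exp P F G \<omega>) = (\<Sum>b\<in>Basis. inner (Z \<omega>) b * ?g b \<omega>)" for \<omega>
    by (simp add: vec_cond_exp_def inner_sum_right mult.commute)
  show "integrable P (\<lambda>\<omega>. inner (Z \<omega>) (vec_cond_exp P F G \<omega>))"
    unfolding eq using coord by (intro Bochner_Integration.integrable_sum)
  have "(\<integral>\<omega>. inner (Z \<omega>) (vec_cond_exp P F G \<omega>) \<partial>P)
      = (\<Sum>b\<in>Basis. \<integral>\<omega>. inner (Z \<omega>) b * inner (G \<omega>) b \<partial>P)"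
    unfolding eq using coord by (subst Bochner_Integration.integral_sum) auto
  also have "\<dots> = (\<integral>\<omega>. (\<Sum>b\<in>Basis. inner (Z \<omega>) b * inner (G \<omega>) b) \<partial>P)"
    using int by (subst Bochner_Integration.integral_sum) auto
  also have "\<dots> = (\<integral>\<omega>. inner (Z \<omega>) (G \<omega>) \<partial>P)"
    by (subst (2) euclidean_inner) simp
  finally show "(\<integral>\<omega>. inner (Z \<omega>) (vec_cond_exp P F G \<omega>) \<partial>P) = (\<integral>\<omega>. inner (Z \<omega>) (G \<omega>) \<partial>P)" .
qed

section \<open>Stochastic subgradient steps for the proximal problem\<close>

context weakly_convex_lipschitz
begin

lemma measurable_prox[measurable (raw)]:
  "Y \<in> borel_measurable N \<Longrightarrow> (\<lambda>\<omega>. prox \<gamma> f (Y \<omega>)) \<in> borel_measurable N"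
  by (rule borel_measurable_continuous_on[OF continuous_prox])

lemma square_integrable_moreau_gradient:
  assumes "prob_space P" and [measurable]: "Y \<in> borel_measurable P"
  shows "square_integrable P (\<lambda>\<omega>. moreau_gradient (Y \<omega>))"
proof -
  interpret prob_space P by fact
  show ?thesis
    by (rule square_integrable_bounded[where B = M])
      (use norm_moreau_gradient_le in \<open>auto simp: moreau_gradient_def\<close>)
qed

lemma prox_eq: "prox \<gamma> f x = x - \<gamma> *\<^sub>R moreau_gradient x"
  using \<gamma>_pos by (simp add: moreau_gradient_def)

lemma square_integrable_prox:
  assumes "prob_space P" "square_integrable P Y"
  shows "square_integrable P (\<lambda>\<omega>. prox \<gamma> f (Y \<omega>))"
  unfolding prox_eq using assms
  by (intro square_integrable_diff square_integrable_scaleR square_integrable_moreau_gradient)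
    (auto simp: square_integrable_def)

text \<open>The envelope grows at most quadratically, by its two quadratic bounds around the origin.\<close>

lemma integrable_moreau:
  assumes "prob_space P" "square_integrable P Y"
  shows "integrable P (\<lambda>\<omega>. moreau \<gamma> f (Y \<omega>))"
proof -
  interpret prob_space P by fact
  have Y[measurable]: "Y \<in> borel_measurable P" and int: "integrable P (\<lambda>\<omega>. (norm (Y \<omega>))\<^sup>2)"
    using assms by (auto simp: square_integrable_def)
  have "isCont (moreau \<gamma> f) z" for z
    using moreau_gderiv[of z] has_derivative_continuous unfolding gderiv_def by blast
  then have "continuous_on UNIV (moreau \<gamma> f)" by (simp add: continuous_at_imp_continuous_on)
  from borel_measurable_continuous_on[OF this Y]
  have meas: "(\<lambda>\<omega>. moreau \<gamma> f (Y \<omega>)) \<in> borel_measurable P" .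
  define K where "K = 1 / (2 * \<gamma>) + 5 / (2 * \<gamma>\<^sup>2 * \<mu>)"
  show ?thesis
  proof (rule Bochner_Integration.integrable_bound[OF _ meas])
    show "integrable P (\<lambda>\<omega>. (\<bar>moreau \<gamma> f 0\<bar> + M) + (M + K) * (norm (Y \<omega>))\<^sup>2)"
      using int by simp
    show "AE \<omega> in P. norm (moreau \<gamma> f (Y \<omega>)) \<le> norm ((\<bar>moreau \<gamma> f 0\<bar> + M) + (M + K) * (norm (Y \<omega>))\<^sup>2)"
    proof (intro AE_I2)
      fix \<omega>
      let ?y = "Y \<omega>"
      have "\<bar>inner (moreau_gradient 0) ?y\<bar> \<le> M * norm ?y"
        using Cauchy_Schwarz_ineq2[of "moreau_gradient 0" ?y]
          mult_right_mono[OF norm_moreau_gradient_le[of 0], of "norm ?y"] by simp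
      also have "norm ?y \<le> 1 + (norm ?y)\<^sup>2"
        using sum_squares_bound[of "norm ?y" 1] norm_ge_zero[of ?y]
        unfolding mult_1_right one_power2 by linarith
      then have "M * norm ?y \<le> M * (1 + (norm ?y)\<^sup>2)"
        using M_nonneg by (intro mult_left_mono)
      finally have 1: "\<bar>inner (moreau_gradient 0) ?y\<bar> \<le> M + M * (norm ?y)\<^sup>2"
        by (simp add: distrib_left)
      have "1 / (2 * \<gamma>) * (norm ?y)\<^sup>2 \<ge> 0" "5 / (2 * \<gamma>\<^sup>2 * \<mu>) * (norm ?y)\<^sup>2 \<ge> 0"
        using \<gamma>_pos \<mu>_pos by auto
      then have "\<bar>moreau \<gamma> f ?y\<bar> \<le> \<bar>moreau \<gamma> f 0\<bar> + M + (M * (norm ?y)\<^sup>2 + K * (norm ?y)\<^sup>2)"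
        using 1 moreau_upper[of ?y 0] moreau_lower[of 0 ?y] unfolding K_def distrib_right by simp
      then show "norm (moreau \<gamma> f ?y) \<le> norm ((\<bar>moreau \<gamma> f 0\<bar> + M) + (M + K) * (norm ?y)\<^sup>2)"
        by (simp add: distrib_right)
    qed
  qed
qed

text \<open>The condition on \<open>\<eta>\<close> makes the second-order term \<open>\<eta>\<^sup>2/\<gamma>\<^sup>2\<close> at most \<open>\<eta> \<mu>/2\<close>, which costs a quarter
  of the first-order decrease \<open>2 \<eta> \<mu>\<close>.\<close>

lemma prox_sgd_contraction_factor:
  assumes "0 < \<eta>" "\<eta> \<le> \<gamma>\<^sup>2 * \<mu> / 2"
  shows "0 \<le> 1 - \<eta> / \<gamma>"
    and "(1 - \<eta> / \<gamma>)\<^sup>2 + 2 * \<eta> * (1 - \<eta> / \<gamma>) * \<delta> \<le> 1 - 3 / 2 * (\<eta> * \<mu>)"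
proof -
  have "\<gamma>\<^sup>2 * \<mu> = \<gamma> * (\<gamma> * \<mu>)" by (simp add: power2_eq_square)
  also have "\<dots> \<le> \<gamma> * 1" using \<gamma>\<mu>_le_1 \<gamma>_pos by (intro mult_left_mono) auto
  finally have "\<eta> \<le> \<gamma>" using assms \<gamma>_pos by simp
  then show a: "0 \<le> 1 - \<eta> / \<gamma>" using \<gamma>_pos by simp
  have "\<eta> / \<gamma>\<^sup>2 \<le> \<mu> / 2"
    using assms(2) \<gamma>_pos by (simp add: field_simps)
  then have "\<eta> * (\<eta> / \<gamma>\<^sup>2) \<le> \<eta> * (\<mu> / 2)" using assms(1) by (intro mult_left_mono) auto
  then have "\<eta> * (\<eta> / \<gamma>\<^sup>2) \<le> 1 / 2 * (\<eta> * \<mu>)" by simp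
  moreover have "(1 - \<eta> / \<gamma>)\<^sup>2 + 2 * \<eta> * (1 - \<eta> / \<gamma>) * \<delta>
      = 1 - 2 * (\<eta> * \<mu>) + \<eta> * (\<eta> / \<gamma>\<^sup>2) - 2 * \<eta> * (\<eta> / \<gamma>) * \<delta>"
    using \<gamma>_pos by (simp add: prox_modulus_def field_simps power2_eq_square)
  moreover have "2 * \<eta> * (\<eta> / \<gamma>) * \<delta> \<ge> 0" using assms(1) \<gamma>_pos \<delta>_nonneg by simp
  ultimately show "(1 - \<eta> / \<gamma>)\<^sup>2 + 2 * \<eta> * (1 - \<eta> / \<gamma>) * \<delta> \<le> 1 - 3 / 2 * (\<eta> * \<mu>)"
    by linarith
qed

text \<open>One stochastic step towards a proximal point \<open>p\<close>. Since \<open>w = (Y - p)/\<gamma>\<close> is a subgradient of \<open>f\<close> at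
  \<open>p\<close>, the step reads \<open>X' - p = (1 - \<eta>/\<gamma>)(X - p) - \<eta> (G - w)\<close>: the quadratic term of the proximal
  objective is treated exactly, and only the subgradient of \<open>f\<close> is noisy. In the mean, \<open>G\<close> may be replaced
  by its conditional expectation, and hypomonotonicity bounds the cross term; the noise contributes at
  most \<open>\<eta>\<^sup>2 (2 M\<^sup>2 + 2 M\<^sup>2)\<close>.\<close>

lemma prox_sgd_step:
  assumes "prob_space P" "subalgebra P F"
    and X: "X \<in> borel_measurable F" "square_integrable P X"
    and Y: "Y \<in> borel_measurable F" "square_integrable P Y"
    and est: "cond_subgradient_estimator P F f M X G"
    and \<eta>: "0 < \<eta>" "\<eta> \<le> \<gamma>\<^sup>2 * \<mu> / 2"
    and X': "\<And>\<omega>. \<omega> \<in> space P \<Longrightarrow> X' \<omega> = X \<omega> - \<eta> *\<^sub>R (G \<omega> + (1 / \<gamma>) *\<^sub>R (X \<omega> - Y \<omega>))"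
  shows "square_integrable P X'"
    and "(\<integral>\<omega>. (norm (X' \<omega> - prox \<gamma> f (Y \<omega>)))\<^sup>2 \<partial>P)
      \<le> (1 - 3 / 2 * (\<eta> * \<mu>)) * (\<integral>\<omega>. (norm (X \<omega> - prox \<gamma> f (Y \<omega>)))\<^sup>2 \<partial>P) + 4 * \<eta>\<^sup>2 * M\<^sup>2"
proof -
  interpret prob_space P by fact
  note G = cond_subgradient_estimator_moment[OF assms(1,2) est]
  have "square_integrable P (\<lambda>\<omega>. X \<omega> - \<eta> *\<^sub>R (G \<omega> + (1 / \<gamma>) *\<^sub>R (X \<omega> - Y \<omega>)))"
    using X Y G by (intro square_integrable_diff square_integrable_add square_integrable_scaleR)
  then show X'_sq: "square_integrable P X'" by (subst square_integrable_cong[OF X'])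
  define Z where "Z \<omega> = X \<omega> - prox \<gamma> f (Y \<omega>)" for \<omega>
  define w where "w \<omega> = moreau_gradient (Y \<omega>)" for \<omega>
  define a where "a = 1 - \<eta> / \<gamma>"
  note factor = prox_sgd_contraction_factor[OF \<eta>, folded a_def]
  have Z_F: "Z \<in> borel_measurable F" using X Y unfolding Z_def by measurable
  have Z: "square_integrable P Z"
    unfolding Z_def using X Y by (intro square_integrable_diff square_integrable_prox assms(1))
  have w: "square_integrable P w"
    unfolding w_def using Y
    by (intro square_integrable_moreau_gradient assms(1)) (simp add: square_integrable_def)
  note ints = square_integrable_norm_sq[OF Z] square_integrable_norm_sq[OF G(1)]
    square_integrable_inner[OF Z G(1)] square_integrable_inner[OF Z w]
  have hypo: "(\<integral>\<omega>. inner (Z \<omega>) (w \<omega>) \<partial>P) - \<delta> * (\<integral>\<omega>. (norm (Z \<omega>))\<^sup>2 \<partial>P)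
      \<le> (\<integral>\<omega>. inner (Z \<omega>) (G \<omega>) \<partial>P)"
  proof -
    note C = inner_vec_cond_exp[OF assms(1,2) Z_F Z G(1)]
    have "(\<integral>\<omega>. inner (Z \<omega>) (w \<omega>) \<partial>P) - \<delta> * (\<integral>\<omega>. (norm (Z \<omega>))\<^sup>2 \<partial>P)
        = (\<integral>\<omega>. inner (Z \<omega>) (w \<omega>) - \<delta> * (norm (Z \<omega>))\<^sup>2 \<partial>P)"
      using ints by simp
    also have "\<dots> \<le> (\<integral>\<omega>. inner (Z \<omega>) (vec_cond_exp P F G \<omega>) \<partial>P)"
    proof (rule integral_mono_AE)
      have "AE \<omega> in P. vec_cond_exp P F G \<omega> \<in> subdifferential f (X \<omega>)"
        using est by (simp add: cond_subgradient_estimator_def)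
      then show "AE \<omega> in P. inner (Z \<omega>) (w \<omega>) - \<delta> * (norm (Z \<omega>))\<^sup>2
          \<le> inner (Z \<omega>) (vec_cond_exp P F G \<omega>)"
      proof eventually_elim
        case (elim \<omega>)
        show ?case
          using weakly_convex_hypomonotone[OF weakly_convex elim moreau_gradient_subgradient[of "Y \<omega>"]]
          unfolding Z_def[symmetric] w_def[symmetric]
          by (simp add: inner_diff_left inner_commute[of "Z \<omega>"])
      qed
    qed (use ints C in auto)
    finally show ?thesis using C(2) by simp
  qed
  have pointwise: "(norm (X' \<omega> - prox \<gamma> f (Y \<omega>)))\<^sup>2
      \<le> a\<^sup>2 * (norm (Z \<omega>))\<^sup>2 - 2 * \<eta> * a * (inner (Z \<omega>) (G \<omega>) - inner (Z \<omega>) (w \<omega>))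
        + (2 * \<eta>\<^sup>2 * (norm (G \<omega>))\<^sup>2 + 2 * \<eta>\<^sup>2 * M\<^sup>2)" if "\<omega> \<in> space P" for \<omega>
  proof -
    have eq: "X' \<omega> - prox \<gamma> f (Y \<omega>) = a *\<^sub>R Z \<omega> - \<eta> *\<^sub>R (G \<omega> - w \<omega>)"
      using \<gamma>_pos by (simp add: X'[OF that] a_def Z_def w_def moreau_gradient_def algebra_simps)
    have "(norm (X' \<omega> - prox \<gamma> f (Y \<omega>)))\<^sup>2
        = a\<^sup>2 * (norm (Z \<omega>))\<^sup>2 - 2 * \<eta> * a * (inner (Z \<omega>) (G \<omega>) - inner (Z \<omega>) (w \<omega>))
          + \<eta>\<^sup>2 * (norm (G \<omega> - w \<omega>))\<^sup>2"
      unfolding eq norm_diff_sq[of "a *\<^sub>R Z \<omega>" "\<eta> *\<^sub>R (G \<omega> - w \<omega>)"]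
      by (simp add: power_mult_distrib) (simp add: inner_diff_right algebra_simps)
    moreover have "(norm (w \<omega>))\<^sup>2 \<le> M\<^sup>2"
      unfolding w_def by (intro power_mono norm_moreau_gradient_le) simp
    then have "(norm (G \<omega> - w \<omega>))\<^sup>2 \<le> 2 * ((norm (G \<omega>))\<^sup>2 + M\<^sup>2)"
      using norm_diff_sq_le[of "G \<omega>" "w \<omega>"] by simp
    then have "\<eta>\<^sup>2 * (norm (G \<omega> - w \<omega>))\<^sup>2 \<le> \<eta>\<^sup>2 * (2 * ((norm (G \<omega>))\<^sup>2 + M\<^sup>2))"
      by (intro mult_left_mono) auto
    ultimately show ?thesis by (simp add: algebra_simps)
  qed
  have "(\<integral>\<omega>. (norm (X' \<omega> - prox \<gamma> f (Y \<omega>)))\<^sup>2 \<partial>P)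
      \<le> (\<integral>\<omega>. a\<^sup>2 * (norm (Z \<omega>))\<^sup>2 - 2 * \<eta> * a * (inner (Z \<omega>) (G \<omega>) - inner (Z \<omega>) (w \<omega>))
        + (2 * \<eta>\<^sup>2 * (norm (G \<omega>))\<^sup>2 + 2 * \<eta>\<^sup>2 * M\<^sup>2) \<partial>P)"
    using pointwise ints X'_sq Y(2)
    by (intro integral_mono) (auto intro!: square_integrable_norm_sq square_integrable_diff
        square_integrable_prox assms(1))
  also have "\<dots> = a\<^sup>2 * (\<integral>\<omega>. (norm (Z \<omega>))\<^sup>2 \<partial>P)
      - 2 * \<eta> * a * ((\<integral>\<omega>. inner (Z \<omega>) (G \<omega>) \<partial>P) - (\<integral>\<omega>. inner (Z \<omega>) (w \<omega>) \<partial>P))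
      + (2 * \<eta>\<^sup>2 * (\<integral>\<omega>. (norm (G \<omega>))\<^sup>2 \<partial>P) + 2 * \<eta>\<^sup>2 * M\<^sup>2)"
    using ints by (simp add: prob_space)
  also have "\<dots> \<le> a\<^sup>2 * (\<integral>\<omega>. (norm (Z \<omega>))\<^sup>2 \<partial>P)
      - 2 * \<eta> * a * (- \<delta> * (\<integral>\<omega>. (norm (Z \<omega>))\<^sup>2 \<partial>P)) + (2 * \<eta>\<^sup>2 * M\<^sup>2 + 2 * \<eta>\<^sup>2 * M\<^sup>2)"
    using hypo G(2) \<eta>(1) factor(1)
    by (intro add_mono diff_mono mult_left_mono order_refl) auto
  also have "\<dots> = (a\<^sup>2 + 2 * \<eta> * a * \<delta>) * (\<integral>\<omega>. (norm (Z \<omega>))\<^sup>2 \<partial>P) + 4 * \<eta>\<^sup>2 * M\<^sup>2"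
    by (simp add: algebra_simps)
  also have "\<dots> \<le> (1 - 3 / 2 * (\<eta> * \<mu>)) * (\<integral>\<omega>. (norm (Z \<omega>))\<^sup>2 \<partial>P) + 4 * \<eta>\<^sup>2 * M\<^sup>2"
    using factor(2) by (intro add_right_mono mult_right_mono) auto
  finally show "(\<integral>\<omega>. (norm (X' \<omega> - prox \<gamma> f (Y \<omega>)))\<^sup>2 \<partial>P)
      \<le> (1 - 3 / 2 * (\<eta> * \<mu>)) * (\<integral>\<omega>. (norm (X \<omega> - prox \<gamma> f (Y \<omega>)))\<^sup>2 \<partial>P) + 4 * \<eta>\<^sup>2 * M\<^sup>2"
    unfolding Z_def .
qed

text \<open>Young's inequality with weight \<open>s\<close>, and the Lipschitz constant of the proximal map.\<close>

lemma prox_drift: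
  assumes "s > 0"
  shows "(norm (x - prox \<gamma> f y'))\<^sup>2
    \<le> (1 + s) * (norm (x - prox \<gamma> f y))\<^sup>2 + (1 + 1 / s) * (1 / (\<gamma> * \<mu>))\<^sup>2 * (norm (y' - y))\<^sup>2"
proof -
  let ?a = "x - prox \<gamma> f y" and ?b = "prox \<gamma> f y - prox \<gamma> f y'"
  have "inner ?a ?b \<le> norm ?a * norm ?b" by (rule norm_cauchy_schwarz)
  moreover have "2 * (norm ?a * norm ?b) \<le> s * (norm ?a)\<^sup>2 + 1 / s * (norm ?b)\<^sup>2"
    using sum_squares_bound[of "s * norm ?a" "norm ?b"] assms
    by (simp add: field_simps power2_eq_square)
  moreover have "(norm (x - prox \<gamma> f y'))\<^sup>2 = (norm ?a)\<^sup>2 + 2 * inner ?a ?b + (norm ?b)\<^sup>2"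
    using norm_add_sq[of ?a ?b] by simp
  ultimately have "(norm (x - prox \<gamma> f y'))\<^sup>2 \<le> (1 + s) * (norm ?a)\<^sup>2 + (1 + 1 / s) * (norm ?b)\<^sup>2"
    unfolding distrib_right by linarith
  moreover have "(norm ?b)\<^sup>2 \<le> (1 / (\<gamma> * \<mu>) * norm (y' - y))\<^sup>2"
    using prox_lipschitz[of y y'] by (intro power_mono) (auto simp: norm_minus_commute)
  then have "(1 + 1 / s) * (norm ?b)\<^sup>2 \<le> (1 + 1 / s) * (1 / (\<gamma> * \<mu>) * norm (y' - y))\<^sup>2"
    using assms by (intro mult_left_mono) auto
  ultimately show ?thesis unfolding power_mult_distrib by (simp add: mult.assoc)
qed

end

section \<open>A uniformly distributed index\<close>

lemma prob_space_with_uniform_index: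
  assumes "prob_space P" "T \<ge> 1"
  shows "prob_space (with_uniform_index P T)"
proof -
  interpret P: prob_space P by fact
  interpret U: prob_space "uniform_count_measure {1..T}"
    by (rule prob_space_uniform_count_measure) (use assms in auto)
  interpret PU: pair_prob_space P "uniform_count_measure {1..T}" by unfold_locales
  show ?thesis unfolding with_uniform_index_def by unfold_locales
qed

text \<open>The index takes finitely many values, so joint measurability can be checked for each value
  separately.\<close>

lemma measurable_with_uniform_index:
  assumes "\<And>t. t \<in> {1..T} \<Longrightarrow> Z t \<in> measurable P N"
  shows "(\<lambda>(\<omega>, t). Z t \<omega>) \<in> measurable (with_uniform_index P T) N"
proof -
  have "(\<lambda>p. Z (fst p) (snd p)) \<in> measurable (count_space {1..T} \<Otimes>\<^sub>M P) N"
    by (rule measurable_pair_measure_countable1) (use assms in auto)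
  then have "(\<lambda>(\<omega>, t). Z t \<omega>) \<in> measurable (P \<Otimes>\<^sub>M count_space {1..T}) N"
    by (subst measurable_pair_swap_iff) (simp add: case_prod_beta')
  moreover have "sets (P \<Otimes>\<^sub>M count_space {1..T}) = sets (with_uniform_index P T)"
    unfolding with_uniform_index_def
    by (intro sets_pair_measure_cong) (auto simp: sets_uniform_count_measure)
  ultimately show ?thesis by (simp cong: measurable_cong_sets)
qed

lemma nn_integral_with_uniform_index:
  assumes "prob_space P" "T \<ge> 1" "\<And>t. t \<in> {1..T} \<Longrightarrow> Z t \<in> borel_measurable P"
  shows "(\<integral>\<^sup>+z. (case z of (\<omega>, t) \<Rightarrow> Z t \<omega>) \<partial>with_uniform_index P T)
    = (\<Sum>t\<in>{1..T}. ennreal (1 / real T) * (\<integral>\<^sup>+\<omega>. Z t \<omega> \<partial>P))"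
proof -
  interpret P: prob_space P by fact
  interpret U: prob_space "uniform_count_measure {1..T}"
    by (rule prob_space_uniform_count_measure) (use assms in auto)
  interpret PU: pair_sigma_finite P "uniform_count_measure {1..T}" by unfold_locales
  have "(\<integral>\<^sup>+z. (case z of (\<omega>, t) \<Rightarrow> Z t \<omega>) \<partial>with_uniform_index P T)
      = (\<integral>\<^sup>+t. (\<integral>\<^sup>+\<omega>. Z t \<omega> \<partial>P) \<partial>uniform_count_measure {1..T})"
    using PU.nn_integral_snd[OF measurable_with_uniform_index[OF assms(3), unfolded with_uniform_index_def]]
    by (simp add: with_uniform_index_def)
  also have "\<dots> = (\<Sum>t\<in>{1..T}. ennreal (1 / real T) * (\<integral>\<^sup>+\<omega>. Z t \<omega> \<partial>P))"
    unfolding uniform_count_measure_def by (subst nn_integral_point_measure_finite) auto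
  finally show ?thesis .
qed

text \<open>The first moment is at most the root mean square. Integrating \<open>r \<le> (r\<^sup>2/c + c)/2\<close>, with \<open>c\<close> the
  bound on the root mean square, avoids square roots of averages.\<close>

lemma nn_integral_uniform_index_le_rms:
  fixes Z :: "nat \<Rightarrow> 'w \<Rightarrow> 'a::euclidean_space"
  assumes "prob_space P" "T \<ge> 1" "c > 0"
    and Z: "\<And>t. t \<in> {1..T} \<Longrightarrow> square_integrable P (Z t)"
    and rms: "1 / real T * (\<Sum>t\<in>{1..T}. \<integral>\<omega>. (norm (Z t \<omega>))\<^sup>2 \<partial>P) \<le> c\<^sup>2"
  shows "(\<integral>\<^sup>+z. (case z of (\<omega>, t) \<Rightarrow> ennreal (norm (Z t \<omega>))) \<partial>with_uniform_index P T) \<le> ennreal c"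
proof -
  interpret P: prob_space P by fact
  let ?q = "\<lambda>t. \<integral>\<omega>. (norm (Z t \<omega>))\<^sup>2 \<partial>P"
  have one: "(\<integral>\<^sup>+\<omega>. ennreal (norm (Z t \<omega>)) \<partial>P) \<le> ennreal ((?q t / c + c) / 2)"
    if t: "t \<in> {1..T}" for t
  proof -
    have int: "integrable P (\<lambda>\<omega>. (norm (Z t \<omega>))\<^sup>2)" using Z[OF t] by (simp add: square_integrable_def)
    have "(\<integral>\<^sup>+\<omega>. ennreal (norm (Z t \<omega>)) \<partial>P) \<le> (\<integral>\<^sup>+\<omega>. ennreal (((norm (Z t \<omega>))\<^sup>2 / c + c) / 2) \<partial>P)"
    proof (intro nn_integral_mono ennreal_leI)
      fix \<omega>
      show "norm (Z t \<omega>) \<le> ((norm (Z t \<omega>))\<^sup>2 / c + c) / 2"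
        using assms(3) sum_squares_bound[of "norm (Z t \<omega>)" c]
        by (simp add: field_simps power2_eq_square)
    qed
    also have "\<dots> = ennreal (\<integral>\<omega>. ((norm (Z t \<omega>))\<^sup>2 / c + c) / 2 \<partial>P)"
      using int assms(3) by (intro nn_integral_eq_integral) (auto intro!: AE_I2)
    also have "(\<integral>\<omega>. ((norm (Z t \<omega>))\<^sup>2 / c + c) / 2 \<partial>P) = (?q t / c + c) / 2"
      using int by (simp add: P.prob_space)
    finally show ?thesis .
  qed
  have "(\<integral>\<^sup>+z. (case z of (\<omega>, t) \<Rightarrow> ennreal (norm (Z t \<omega>))) \<partial>with_uniform_index P T)
      = (\<Sum>t\<in>{1..T}. ennreal (1 / real T) * (\<integral>\<^sup>+\<omega>. ennreal (norm (Z t \<omega>)) \<partial>P))"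
    by (intro nn_integral_with_uniform_index assms(1,2) measurable_compose[OF _ measurable_ennreal]
        measurable_compose[OF square_integrable_measurable[OF Z] borel_measurable_norm])
  also have "\<dots> \<le> (\<Sum>t\<in>{1..T}. ennreal (1 / real T) * ennreal ((?q t / c + c) / 2))"
    using one by (intro sum_mono mult_left_mono) auto
  also have "\<dots> = (\<Sum>t\<in>{1..T}. ennreal (1 / real T * ((?q t / c + c) / 2)))"
    using assms(3) by (intro sum.cong refl ennreal_mult[symmetric]) (auto intro!: add_nonneg_nonneg divide_nonneg_nonneg)
  also have "\<dots> = ennreal (\<Sum>t\<in>{1..T}. 1 / real T * ((?q t / c + c) / 2))"
    using assms(3) by (intro sum_ennreal) (auto intro!: add_nonneg_nonneg divide_nonneg_nonneg mult_nonneg_nonneg)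
  also have "(\<Sum>t\<in>{1..T}. 1 / real T * ((?q t / c + c) / 2))
      = (1 / real T * (\<Sum>t\<in>{1..T}. ?q t) / c + c) / 2"
    using assms(2) by (simp add: sum_divide_distrib[symmetric] sum.distrib field_simps)
  also have "\<dots> \<le> (c\<^sup>2 / c + c) / 2"
    using rms assms(3) by (intro divide_right_mono add_right_mono) auto
  also have "\<dots> = c" using assms(3) by (simp add: power2_eq_square)
  finally show ?thesis by (simp add: ennreal_leI)
qed

section \<open>Tracking a moving proximal point\<close>

context weakly_convex_lipschitz
begin

text \<open>The step-size conditions in the two forms in which they are used; both rest on \<open>\<gamma> \<mu> \<le> 1\<close>.\<close>

lemma step_size_products:
  assumes "0 < \<alpha>" "\<alpha> \<le> \<mu> / 2" "0 < \<eta>" "\<eta> \<le> \<gamma>\<^sup>2 * \<mu> / 2"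
  shows "4 * (\<eta> * \<alpha>) \<le> 1" and "32 * (\<gamma>\<^sup>2 * \<alpha>\<^sup>2 / 4 * \<eta>) \<le> \<gamma>\<^sup>2 * \<mu>"
proof -
  have sq: "(\<gamma> * \<mu>)\<^sup>2 \<le> 1"
    using \<gamma>\<mu>_le_1 \<gamma>_pos \<mu>_pos by (intro power_le_one) auto
  have "\<eta> * \<alpha> \<le> (\<gamma>\<^sup>2 * \<mu> / 2) * (\<mu> / 2)" using assms by (intro mult_mono) auto
  also have "\<dots> = (\<gamma> * \<mu>)\<^sup>2 / 4" by (simp add: power2_eq_square)
  finally show le: "4 * (\<eta> * \<alpha>) \<le> 1" using sq by simp
  have "32 * (\<gamma>\<^sup>2 * \<alpha>\<^sup>2 / 4 * \<eta>) = \<gamma>\<^sup>2 * (4 * (\<eta> * \<alpha>)) * (2 * \<alpha>)"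
    by (simp add: power2_eq_square)
  also have "\<dots> \<le> \<gamma>\<^sup>2 * 1 * \<mu>"
    using le assms by (intro mult_mono mult_nonneg_nonneg) auto
  finally show "32 * (\<gamma>\<^sup>2 * \<alpha>\<^sup>2 / 4 * \<eta>) \<le> \<gamma>\<^sup>2 * \<mu>" by simp
qed

text \<open>The iterate \<open>X\<close> was close to the proximal point of the old centre \<open>Y\<^sub>0\<close>; the next step contracts
  towards that of the new centre \<open>Y\<close>. The contraction \<open>1 - 3 \<eta> \<alpha>\<close> of the stochastic step absorbs the
  factor \<open>1 + \<eta> \<alpha>\<close> from the drift, so Young's inequality is applied with weight \<open>\<eta> \<alpha>\<close>.\<close>

lemma prox_tracking_step:
  assumes "prob_space P" "subalgebra P F"
    and X: "X \<in> borel_measurable F" "square_integrable P X"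
    and Y: "Y \<in> borel_measurable F" "square_integrable P Y"
    and Y\<^sub>0: "square_integrable P Y\<^sub>0"
    and est: "cond_subgradient_estimator P F f M X G"
    and \<eta>: "0 < \<eta>" "\<eta> \<le> \<gamma>\<^sup>2 * \<mu> / 2" and \<alpha>: "0 < \<alpha>" "\<alpha> \<le> \<mu> / 2"
    and X': "\<And>\<omega>. \<omega> \<in> space P \<Longrightarrow> X' \<omega> = X \<omega> - \<eta> *\<^sub>R (G \<omega> + (1 / \<gamma>) *\<^sub>R (X \<omega> - Y \<omega>))"
  shows "(\<integral>\<omega>. (norm (X' \<omega> - prox \<gamma> f (Y \<omega>)))\<^sup>2 \<partial>P)
    \<le> (1 - 2 * (\<eta> * \<alpha>)) * (\<integral>\<omega>. (norm (X \<omega> - prox \<gamma> f (Y\<^sub>0 \<omega>)))\<^sup>2 \<partial>P)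
      + 1 / (4 * \<gamma>\<^sup>2 * \<alpha> ^ 3 * \<eta>) * (\<integral>\<omega>. (norm (Y \<omega> - Y\<^sub>0 \<omega>))\<^sup>2 \<partial>P) + 4 * \<eta>\<^sup>2 * M\<^sup>2"
proof -
  let ?new = "\<integral>\<omega>. (norm (X \<omega> - prox \<gamma> f (Y \<omega>)))\<^sup>2 \<partial>P"
  let ?old = "\<integral>\<omega>. (norm (X \<omega> - prox \<gamma> f (Y\<^sub>0 \<omega>)))\<^sup>2 \<partial>P"
  let ?shift = "\<integral>\<omega>. (norm (Y \<omega> - Y\<^sub>0 \<omega>))\<^sup>2 \<partial>P"
  define s where "s = \<eta> * \<alpha>"
  define L where "L = (1 / (\<gamma> * \<mu>))\<^sup>2"
  have s: "0 < s" "4 * s \<le> 1"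
    using \<eta> \<alpha> step_size_products(1)[OF \<alpha> \<eta>] by (auto simp: s_def)
  have ints: "integrable P (\<lambda>\<omega>. (norm (X \<omega> - prox \<gamma> f (Y \<omega>)))\<^sup>2)"
    "integrable P (\<lambda>\<omega>. (norm (X \<omega> - prox \<gamma> f (Y\<^sub>0 \<omega>)))\<^sup>2)"
    "integrable P (\<lambda>\<omega>. (norm (Y \<omega> - Y\<^sub>0 \<omega>))\<^sup>2)"
    using X Y Y\<^sub>0 assms(1)
    by (auto intro!: square_integrable_norm_sq square_integrable_diff square_integrable_prox)
  have "?new \<le> (\<integral>\<omega>. (1 + s) * (norm (X \<omega> - prox \<gamma> f (Y\<^sub>0 \<omega>)))\<^sup>2
      + (1 + 1 / s) * L * (norm (Y \<omega> - Y\<^sub>0 \<omega>))\<^sup>2 \<partial>P)"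
    unfolding L_def using ints prox_drift[OF s(1)] by (intro integral_mono) auto
  also have "\<dots> = (1 + s) * ?old + (1 + 1 / s) * L * ?shift"
    using ints by simp
  finally have drift: "?new \<le> (1 + s) * ?old + (1 + 1 / s) * L * ?shift" .
  have nonneg: "?new \<ge> 0" "?old \<ge> 0" "?shift \<ge> 0" by auto
  have "3 * s \<le> 3 / 2 * (\<eta> * \<mu>)"
    using \<eta> \<alpha> mult_left_mono[OF \<alpha>(2), of \<eta>] by (simp add: s_def)
  \<comment> \<open>Contract towards the new proximal point, then return to the old one.\<close>
  have "(\<integral>\<omega>. (norm (X' \<omega> - prox \<gamma> f (Y \<omega>)))\<^sup>2 \<partial>P) \<le> (1 - 3 / 2 * (\<eta> * \<mu>)) * ?new + 4 * \<eta>\<^sup>2 * M\<^sup>2"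
    by (rule prox_sgd_step(2)[OF assms(1,2) X Y est \<eta> X'])
  also have "\<dots> \<le> (1 - 3 * s) * ?new + 4 * \<eta>\<^sup>2 * M\<^sup>2"
    using \<open>3 * s \<le> _\<close> nonneg by (intro add_right_mono mult_right_mono) auto
  also have "\<dots> \<le> (1 - 3 * s) * ((1 + s) * ?old + (1 + 1 / s) * L * ?shift) + 4 * \<eta>\<^sup>2 * M\<^sup>2"
    using drift s by (intro add_right_mono mult_left_mono) auto
  also have "\<dots> = ((1 - 3 * s) * (1 + s)) * ?old + ((1 - 3 * s) * (1 + 1 / s) * L) * ?shift + 4 * \<eta>\<^sup>2 * M\<^sup>2"
    by (subst distrib_left) (simp only: mult.assoc)
  also have "\<dots> \<le> (1 - 2 * s) * ?old + (1 / (4 * \<gamma>\<^sup>2 * \<alpha> ^ 3 * \<eta>)) * ?shift + 4 * \<eta>\<^sup>2 * M\<^sup>2"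
  proof (intro add_mono mult_right_mono nonneg order_refl)
    show "(1 - 3 * s) * (1 + s) \<le> 1 - 2 * s" using s by (simp add: algebra_simps)
    have "(1 - 3 * s) * (1 + 1 / s) = 1 / s - 2 - 3 * s" using s by (simp add: field_simps)
    also have "\<dots> \<le> 1 / s" using s by simp
    finally have 1: "(1 - 3 * s) * (1 + 1 / s) \<le> 1 / s" .
    have "\<gamma> * (2 * \<alpha>) \<le> \<gamma> * \<mu>" using \<alpha> \<gamma>_pos by (intro mult_left_mono) auto
    then have "1 / (\<gamma> * \<mu>) \<le> 1 / (\<gamma> * (2 * \<alpha>))"
      using \<alpha> \<gamma>_pos \<mu>_pos by (intro divide_left_mono) auto
    then have "L \<le> (1 / (\<gamma> * (2 * \<alpha>)))\<^sup>2"
      unfolding L_def using \<gamma>_pos \<mu>_pos by (intro power_mono) auto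
    then have "(1 - 3 * s) * (1 + 1 / s) * L \<le> 1 / s * (1 / (\<gamma> * (2 * \<alpha>)))\<^sup>2"
      using 1 s by (intro mult_mono) (auto simp: L_def)
    also have "\<dots> = 1 / (4 * \<gamma>\<^sup>2 * \<alpha> ^ 3 * \<eta>)"
      by (simp add: s_def field_simps power2_eq_square power3_eq_cube)
    finally show "(1 - 3 * s) * (1 + 1 / s) * L \<le> 1 / (4 * \<gamma>\<^sup>2 * \<alpha> ^ 3 * \<eta>)" .
  qed auto
  finally show ?thesis unfolding s_def .
qed

end

section \<open>The difference of two Moreau envelopes\<close>

locale difference_weakly_convex =
  A: weakly_convex_lipschitz \<phi> \<delta>\<phi> \<gamma> M + B: weakly_convex_lipschitz \<psi> \<delta>\<psi> \<gamma> M
  for \<phi> \<psi> :: "'a::euclidean_space \<Rightarrow> real" and \<delta>\<phi> \<delta>\<psi> \<gamma> M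
begin

definition envelope :: "'a \<Rightarrow> real" where
  "envelope x = moreau \<gamma> \<phi> x - moreau \<gamma> \<psi> x"

definition envelope_gradient :: "'a \<Rightarrow> 'a" where
  "envelope_gradient x = A.moreau_gradient x - B.moreau_gradient x"

lemma envelope_gradient_eq:
  "envelope_gradient x = (1 / \<gamma>) *\<^sub>R (prox \<gamma> \<psi> x - prox \<gamma> \<phi> x)"
  by (simp add: envelope_gradient_def A.moreau_gradient_def B.moreau_gradient_def algebra_simps)

text \<open>The right-hand side is a gradient of the envelope, and \<^const>\<open>gradient\<close> is well defined because
  gradients are unique.\<close>

lemma gradient_envelope: "gradient envelope x = envelope_gradient x"
proof -
  have D: "GDERIV envelope x :> envelope_gradient x"
    unfolding envelope_def[abs_def] envelope_gradient_def
    by (rule GDERIV_diff[OF A.moreau_gderiv B.moreau_gderiv])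
  show ?thesis
    unfolding gradient_def
  proof (rule the_equality)
    show "GDERIV envelope x :> envelope_gradient x" by (rule D)
    fix d assume "GDERIV envelope x :> d"
    then have "(\<lambda>h. inner h d) = (\<lambda>h. inner h (envelope_gradient x))"
      using D has_derivative_unique unfolding gderiv_def by blast
    then have "inner h d = inner h (envelope_gradient x)" for h by meson
    then show "d = envelope_gradient x" using vector_eq_ldot by blast
  qed
qed

text \<open>Inexact gradient descent. By polarization
  \<open>-2 \<langle>D, G\<rangle> = norm (D - G)\<^sup>2 - norm D\<^sup>2 - norm G\<^sup>2\<close>, where \<open>D\<close> is the exact gradient, and \<open>D - G\<close> is the
  difference of the two tracking errors divided by \<open>\<gamma>\<close>. The curvature of the difference of envelopes from
  above comes from the upper bound for \<open>\<phi>\<close> and the lower bound for \<open>\<psi>\<close>, so only the modulus of \<open>\<psi>\<close> matters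
  for the step size. A negative multiple of \<open>norm G\<^sup>2\<close> survives; it pays for the drift of the centres.\<close>

lemma envelope_descent:
  assumes "0 < \<eta>\<^sub>0" "8 * \<eta>\<^sub>0 \<le> \<gamma>\<^sup>2 * B.prox_modulus"
    and G: "G = (1 / \<gamma>) *\<^sub>R (v - u)" and y: "y = x - \<eta>\<^sub>0 *\<^sub>R G"
  shows "envelope y \<le> envelope x - \<eta>\<^sub>0 / 2 * (norm (envelope_gradient x))\<^sup>2 - \<eta>\<^sub>0 / 8 * (norm G)\<^sup>2
    + \<eta>\<^sub>0 / \<gamma>\<^sup>2 * ((norm (u - prox \<gamma> \<phi> x))\<^sup>2 + (norm (v - prox \<gamma> \<psi> x))\<^sup>2)"
proof -
  note \<gamma>_pos = A.\<gamma>_pos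
  let ?D = "envelope_gradient x" and ?\<mu> = "B.prox_modulus"
  have \<mu>: "?\<mu> > 0" by (rule B.\<mu>_pos)
  have yx: "y - x = - (\<eta>\<^sub>0 *\<^sub>R G)" by (simp add: y)
  have "2 * \<gamma>\<^sup>2 * ?\<mu> = 2 * \<gamma> * (\<gamma> * ?\<mu>)" by (simp add: power2_eq_square)
  also have "\<dots> \<le> 2 * \<gamma> * 1" using B.\<gamma>\<mu>_le_1 \<gamma>_pos by (intro mult_left_mono) auto
  finally have "1 / (2 * \<gamma>) \<le> 1 / (2 * \<gamma>\<^sup>2 * ?\<mu>)" using \<gamma>_pos \<mu> by (intro divide_left_mono) auto
  moreover have "1 / (2 * \<gamma>\<^sup>2 * ?\<mu>) + 5 / (2 * \<gamma>\<^sup>2 * ?\<mu>) = 3 / (\<gamma>\<^sup>2 * ?\<mu>)"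
    by (simp add: add_divide_distrib[symmetric])
  ultimately have "1 / (2 * \<gamma>) + 5 / (2 * \<gamma>\<^sup>2 * ?\<mu>) \<le> 3 / (\<gamma>\<^sup>2 * ?\<mu>)" by linarith
  then have curv: "(1 / (2 * \<gamma>) + 5 / (2 * \<gamma>\<^sup>2 * ?\<mu>)) * (\<eta>\<^sub>0\<^sup>2 * (norm G)\<^sup>2)
      \<le> 3 / (\<gamma>\<^sup>2 * ?\<mu>) * (\<eta>\<^sub>0\<^sup>2 * (norm G)\<^sup>2)"
    by (intro mult_right_mono) auto
  have "\<eta>\<^sub>0 / (\<gamma>\<^sup>2 * ?\<mu>) \<le> 1 / 8" using assms(2) \<gamma>_pos \<mu> by (simp add: field_simps)
  then have "\<eta>\<^sub>0 / (\<gamma>\<^sup>2 * ?\<mu>) * (3 * \<eta>\<^sub>0 * (norm G)\<^sup>2) \<le> 1 / 8 * (3 * \<eta>\<^sub>0 * (norm G)\<^sup>2)"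
    using assms(1) by (intro mult_right_mono) auto
  then have curv': "3 / (\<gamma>\<^sup>2 * ?\<mu>) * (\<eta>\<^sub>0\<^sup>2 * (norm G)\<^sup>2) \<le> 3 / 8 * (\<eta>\<^sub>0 * (norm G)\<^sup>2)"
    by (simp add: power2_eq_square mult_ac)
  have "envelope y \<le> envelope x + inner ?D (y - x)
      + (1 / (2 * \<gamma>) + 5 / (2 * \<gamma>\<^sup>2 * ?\<mu>)) * (norm (y - x))\<^sup>2"
    using A.moreau_upper[of y x] B.moreau_lower[of x y]
    unfolding envelope_def envelope_gradient_def inner_diff_left distrib_right by linarith
  also have "(norm (y - x))\<^sup>2 = \<eta>\<^sub>0\<^sup>2 * (norm G)\<^sup>2" by (simp add: yx power_mult_distrib)
  also have "inner ?D (y - x) = - (\<eta>\<^sub>0 * inner ?D G)" by (simp add: yx)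
  finally have 1: "envelope y \<le> envelope x - \<eta>\<^sub>0 * inner ?D G + 3 / 8 * (\<eta>\<^sub>0 * (norm G)\<^sup>2)"
    using curv curv' by linarith
  have "\<eta>\<^sub>0 * (norm (?D - G))\<^sup>2
      = \<eta>\<^sub>0 * (norm ?D)\<^sup>2 - 2 * (\<eta>\<^sub>0 * inner ?D G) + \<eta>\<^sub>0 * (norm G)\<^sup>2"
    unfolding norm_diff_sq by (simp add: algebra_simps)
  moreover have "\<eta>\<^sub>0 * (norm (?D - G))\<^sup>2
      \<le> 2 * (\<eta>\<^sub>0 / \<gamma>\<^sup>2 * ((norm (u - prox \<gamma> \<phi> x))\<^sup>2 + (norm (v - prox \<gamma> \<psi> x))\<^sup>2))"
  proof -
    have "?D - G = (1 / \<gamma>) *\<^sub>R ((u - prox \<gamma> \<phi> x) - (v - prox \<gamma> \<psi> x))"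
      by (simp add: envelope_gradient_eq G algebra_simps)
    then have "\<eta>\<^sub>0 * (norm (?D - G))\<^sup>2
        = \<eta>\<^sub>0 / \<gamma>\<^sup>2 * (norm ((u - prox \<gamma> \<phi> x) - (v - prox \<gamma> \<psi> x)))\<^sup>2"
      by (simp add: power_divide)
    also have "\<dots> \<le> \<eta>\<^sub>0 / \<gamma>\<^sup>2 * (2 * ((norm (u - prox \<gamma> \<phi> x))\<^sup>2 + (norm (v - prox \<gamma> \<psi> x))\<^sup>2))"
      using assms(1) by (intro mult_left_mono norm_diff_sq_le) auto
    finally show ?thesis by (simp only: mult.left_commute)
  qed
  ultimately have "- (\<eta>\<^sub>0 * inner ?D G) \<le> - (\<eta>\<^sub>0 * (norm ?D)\<^sup>2 / 2) - \<eta>\<^sub>0 * (norm G)\<^sup>2 / 2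
      + \<eta>\<^sub>0 / \<gamma>\<^sup>2 * ((norm (u - prox \<gamma> \<phi> x))\<^sup>2 + (norm (v - prox \<gamma> \<psi> x))\<^sup>2)"
    by linarith
  then show ?thesis using 1 by simp
qed

lemma square_integrable_envelope_gradient:
  assumes "prob_space P" "square_integrable P Y"
  shows "square_integrable P (\<lambda>\<omega>. envelope_gradient (Y \<omega>))"
  unfolding envelope_gradient_def using assms
  by (intro square_integrable_diff A.square_integrable_moreau_gradient
      B.square_integrable_moreau_gradient) (auto simp: square_integrable_def)

lemma integrable_envelope:
  assumes "prob_space P" "square_integrable P Y"
  shows "integrable P (\<lambda>\<omega>. envelope (Y \<omega>))"
  unfolding envelope_def using assms
  by (intro Bochner_Integration.integrable_diff A.integrable_moreau B.integrable_moreau)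

text \<open>At a centre \<open>Y\<close>, the gradient of the envelope is a difference of subgradients of \<open>\<phi>\<close> and \<open>\<psi>\<close> at the two
  proximal points, and the proximal points are \<open>\<gamma>\<close> times that gradient apart. So the gradient and the two
  proximal points are the witnesses, and a point close to one proximal point is close to the other one.
  The factor \<open>min 1 (1 / \<gamma>\<^sup>2)\<close> keeps both the gradient and \<open>\<gamma>\<close> times the gradient small.\<close>

lemma nearly_critical_uniform_index:
  fixes P :: "'w measure" and X Y Z :: "nat \<Rightarrow> 'w \<Rightarrow> 'a"
  assumes "prob_space P" "T \<ge> 1" "\<epsilon> > 0"
    and X: "\<And>t. t \<in> {1..T} \<Longrightarrow> square_integrable P (X t)"
    and Y: "\<And>t. t \<in> {1..T} \<Longrightarrow> square_integrable P (Y t)"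
    and Z: "\<And>t. t \<in> {1..T} \<Longrightarrow> square_integrable P (Z t)"
    and near: "\<And>t \<omega>. norm (X t \<omega> - prox \<gamma> \<phi> (Y t \<omega>))
        \<le> norm (Z t \<omega>) + norm (\<gamma> *\<^sub>R envelope_gradient (Y t \<omega>))"
      "\<And>t \<omega>. norm (X t \<omega> - prox \<gamma> \<psi> (Y t \<omega>))
        \<le> norm (Z t \<omega>) + norm (\<gamma> *\<^sub>R envelope_gradient (Y t \<omega>))"
    and mean: "1 / real T * (\<Sum>t\<in>{1..T}. (\<integral>\<omega>. (norm (Z t \<omega>))\<^sup>2 \<partial>P)
        + (\<integral>\<omega>. (norm (envelope_gradient (Y t \<omega>)))\<^sup>2 \<partial>P)) \<le> min 1 (1 / \<gamma>\<^sup>2) * (\<epsilon>\<^sup>2 / 4)"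
  shows "nearly_critical (with_uniform_index P T) \<phi> \<psi> \<epsilon> (\<lambda>(\<omega>, t). X t \<omega>)"
proof -
  interpret P: prob_space P by fact
  let ?Q = "with_uniform_index P T"
  let ?D = "\<lambda>t \<omega>. envelope_gradient (Y t \<omega>)"
  let ?z = "\<Sum>t\<in>{1..T}. \<integral>\<omega>. (norm (Z t \<omega>))\<^sup>2 \<partial>P"
  let ?d = "\<Sum>t\<in>{1..T}. \<integral>\<omega>. (norm (?D t \<omega>))\<^sup>2 \<partial>P"
  note D = square_integrable_envelope_gradient[OF assms(1) Y]
  have pos: "1 / real T * ?z \<ge> 0" "1 / real T * ?d \<ge> 0"
    by (auto intro!: divide_nonneg_nonneg sum_nonneg)
  have mean': "1 / real T * ?z + 1 / real T * ?d \<le> min 1 (1 / \<gamma>\<^sup>2) * (\<epsilon>\<^sup>2 / 4)"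
    using mean by (simp only: sum.distrib distrib_left)
  have m1: "min 1 (1 / \<gamma>\<^sup>2) * (\<epsilon>\<^sup>2 / 4) \<le> (\<epsilon> / 2)\<^sup>2"
    using mult_right_mono[of "min 1 (1 / \<gamma>\<^sup>2)" 1 "\<epsilon>\<^sup>2 / 4"] by (simp add: power_divide)
  have half: "(\<epsilon> / 2)\<^sup>2 \<le> \<epsilon>\<^sup>2" using assms(3) by (intro power_mono) auto
  have z_le: "1 / real T * ?z \<le> (\<epsilon> / 2)\<^sup>2" and d_le: "1 / real T * ?d \<le> \<epsilon>\<^sup>2"
    using mean' m1 pos half by linarith+
  have d_le': "1 / real T * ?d \<le> min 1 (1 / \<gamma>\<^sup>2) * (\<epsilon>\<^sup>2 / 4)"
    using mean' pos by linarith
  have m2: "\<gamma>\<^sup>2 * (min 1 (1 / \<gamma>\<^sup>2) * (\<epsilon>\<^sup>2 / 4)) \<le> \<epsilon>\<^sup>2 / 4"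
  proof -
    have "\<gamma>\<^sup>2 * min 1 (1 / \<gamma>\<^sup>2) \<le> \<gamma>\<^sup>2 * (1 / \<gamma>\<^sup>2)" by (intro mult_left_mono) auto
    also have "\<dots> = 1" using A.\<gamma>_pos by simp
    finally have "\<gamma>\<^sup>2 * min 1 (1 / \<gamma>\<^sup>2) * (\<epsilon>\<^sup>2 / 4) \<le> 1 * (\<epsilon>\<^sup>2 / 4)" by (intro mult_right_mono) auto
    then show ?thesis by (simp add: mult.assoc)
  qed
  have Z_mean: "(\<integral>\<^sup>+z. (case z of (\<omega>, t) \<Rightarrow> ennreal (norm (Z t \<omega>))) \<partial>?Q) \<le> ennreal (\<epsilon> / 2)"
    by (intro nn_integral_uniform_index_le_rms assms Z z_le) (use assms(3) in auto)
  have D_mean: "(\<integral>\<^sup>+z. (case z of (\<omega>, t) \<Rightarrow> ennreal (norm (?D t \<omega>))) \<partial>?Q) \<le> ennreal \<epsilon>"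
    by (intro nn_integral_uniform_index_le_rms assms D d_le)
  have "(\<integral>\<^sup>+z. (case z of (\<omega>, t) \<Rightarrow> ennreal (norm (\<gamma> *\<^sub>R ?D t \<omega>))) \<partial>?Q) \<le> ennreal (\<epsilon> / 2)"
  proof (intro nn_integral_uniform_index_le_rms assms square_integrable_scaleR D)
    have "1 / real T * (\<Sum>t\<in>{1..T}. \<integral>\<omega>. (norm (\<gamma> *\<^sub>R ?D t \<omega>))\<^sup>2 \<partial>P) = \<gamma>\<^sup>2 * (1 / real T * ?d)"
      by (simp add: power_mult_distrib sum_distrib_left)
    also have "\<dots> \<le> \<gamma>\<^sup>2 * (min 1 (1 / \<gamma>\<^sup>2) * (\<epsilon>\<^sup>2 / 4))"
      by (intro mult_left_mono d_le') simp
    finally show "1 / real T * (\<Sum>t\<in>{1..T}. \<integral>\<omega>. (norm (\<gamma> *\<^sub>R ?D t \<omega>))\<^sup>2 \<partial>P) \<le> (\<epsilon> / 2)\<^sup>2"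
      using m2 by (simp add: power_divide)
  qed (use assms(3) in auto)
  note gap_mean = this
  have meas: "\<And>W. (\<And>t. t \<in> {1..T} \<Longrightarrow> square_integrable P (W t)) \<Longrightarrow>
      (\<lambda>(\<omega>, t). W t \<omega>) \<in> borel_measurable ?Q"
    by (intro measurable_with_uniform_index) (auto simp: square_integrable_def)
  have meas_norm: "\<And>W. (\<And>t. t \<in> {1..T} \<Longrightarrow> square_integrable P (W t)) \<Longrightarrow>
      (\<lambda>(\<omega>, t). ennreal (norm (W t \<omega> :: 'a))) \<in> borel_measurable ?Q"
    by (intro measurable_with_uniform_index measurable_compose[OF _ measurable_ennreal]
        measurable_compose[OF _ borel_measurable_norm]) (auto simp: square_integrable_def)
  have Z_meas: "(\<lambda>(\<omega>, t). ennreal (norm (Z t \<omega>))) \<in> borel_measurable ?Q"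
    by (rule meas_norm) (rule Z)
  have D_meas: "(\<lambda>(\<omega>, t). ennreal (norm (\<gamma> *\<^sub>R ?D t \<omega>))) \<in> borel_measurable ?Q"
    by (rule meas_norm) (rule square_integrable_scaleR[OF D])
  have dist: "(\<integral>\<^sup>+z. ennreal (norm (h z)) \<partial>?Q) \<le> ennreal \<epsilon>"
    if "\<And>\<omega> t. norm (h (\<omega>, t)) \<le> norm (Z t \<omega>) + norm (\<gamma> *\<^sub>R ?D t \<omega>)" for h :: "'w \<times> nat \<Rightarrow> 'a"
  proof -
    have "(\<integral>\<^sup>+z. ennreal (norm (h z)) \<partial>?Q) \<le> (\<integral>\<^sup>+z. (case z of (\<omega>, t) \<Rightarrow> ennreal (norm (Z t \<omega>)))
        + (case z of (\<omega>, t) \<Rightarrow> ennreal (norm (\<gamma> *\<^sub>R ?D t \<omega>))) \<partial>?Q)"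
      using that by (intro nn_integral_mono) (auto simp: ennreal_plus[symmetric] simp del: ennreal_plus norm_scaleR intro!: ennreal_leI)
    also have "\<dots> = (\<integral>\<^sup>+z. (case z of (\<omega>, t) \<Rightarrow> ennreal (norm (Z t \<omega>))) \<partial>?Q)
        + (\<integral>\<^sup>+z. (case z of (\<omega>, t) \<Rightarrow> ennreal (norm (\<gamma> *\<^sub>R ?D t \<omega>))) \<partial>?Q)"
      by (intro nn_integral_add Z_meas D_meas)
    also have "\<dots> \<le> ennreal (\<epsilon> / 2) + ennreal (\<epsilon> / 2)"
      by (intro add_mono Z_mean gap_mean)
    also have "\<dots> = ennreal \<epsilon>" using assms(3) by (subst ennreal_plus[symmetric]) auto
    finally show ?thesis .
  qed
  let ?V = "\<lambda>(\<omega>, t). ?D t \<omega>"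
  let ?X1 = "\<lambda>(\<omega>, t). prox \<gamma> \<phi> (Y t \<omega>)" and ?X2 = "\<lambda>(\<omega>, t). prox \<gamma> \<psi> (Y t \<omega>)"
  show ?thesis
    unfolding nearly_critical_def
  proof (intro conjI; (rule exI[of _ ?V], rule exI[of _ ?X1], rule exI[of _ ?X2], intro conjI)?)
    show "prob_space ?Q" by (intro prob_space_with_uniform_index assms)
    show "(\<lambda>(\<omega>, t). X t \<omega>) \<in> borel_measurable ?Q" by (intro meas X)
    show "?V \<in> borel_measurable ?Q" by (intro meas D)
    show "?X1 \<in> borel_measurable ?Q" by (intro meas A.square_integrable_prox Y assms(1))
    show "?X2 \<in> borel_measurable ?Q" by (intro meas B.square_integrable_prox Y assms(1))
    show "AE z in ?Q. ?V z \<in> {a - b |a b. a \<in> subdifferential \<phi> (?X1 z) \<and> b \<in> subdifferential \<psi> (?X2 z)}"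
      using A.moreau_gradient_subgradient B.moreau_gradient_subgradient
      by (intro AE_I2) (auto simp: envelope_gradient_def)
    have "(\<integral>\<^sup>+z. ennreal (norm (?V z)) \<partial>?Q) \<le> ennreal \<epsilon>"
      using D_mean by (simp add: case_prod_beta')
    moreover have "(\<integral>\<^sup>+z. ennreal (norm ((case z of (\<omega>, t) \<Rightarrow> X t \<omega>) - ?X1 z)) \<partial>?Q) \<le> ennreal \<epsilon>"
      using dist[of "\<lambda>z. (case z of (\<omega>, t) \<Rightarrow> X t \<omega>) - ?X1 z"] near by simp
    moreover have "(\<integral>\<^sup>+z. ennreal (norm ((case z of (\<omega>, t) \<Rightarrow> X t \<omega>) - ?X2 z)) \<partial>?Q) \<le> ennreal \<epsilon>"
      using dist[of "\<lambda>z. (case z of (\<omega>, t) \<Rightarrow> X t \<omega>) - ?X2 z"] near by simp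
    ultimately show "max (\<integral>\<^sup>+z. ennreal (norm (?V z)) \<partial>?Q)
        (max (\<integral>\<^sup>+z. ennreal (norm ((case z of (\<omega>, t) \<Rightarrow> X t \<omega>) - ?X1 z)) \<partial>?Q)
          (\<integral>\<^sup>+z. ennreal (norm ((case z of (\<omega>, t) \<Rightarrow> X t \<omega>) - ?X2 z)) \<partial>?Q)) \<le> ennreal \<epsilon>"
      by (intro max.boundedI)
  qed
qed

end

section \<open>The Lyapunov argument and the choice of parameters\<close>

text \<open>Telescoping of the potential \<open>e + \<alpha>/2 D\<close>, where \<open>e\<close> is the objective and \<open>D\<close> the tracking error. The
  weight \<open>\<alpha>/2\<close> is such that the drift term \<open>\<eta>\<^sub>0/(8 \<alpha>) S\<close> costs only half of the decrease \<open>\<eta>\<^sub>0/8 S\<close>, while the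
  contraction yields \<open>\<eta> \<alpha>\<^sup>2 D\<close>, four times the gradient error \<open>\<eta>\<^sub>0/\<gamma>\<^sup>2 D\<close>.\<close>

lemma lyapunov_sum_bound:
  fixes e D N S :: "nat \<Rightarrow> real"
  assumes pos: "0 < \<alpha>" "0 < \<gamma>" "0 < \<eta>" "2 * (\<eta> * \<alpha>) \<le> 1" "0 \<le> C"
    and \<eta>\<^sub>0: "\<eta>\<^sub>0 = \<gamma>\<^sup>2 * \<alpha>\<^sup>2 / 4 * \<eta>"
    and nonneg: "\<And>t. 0 \<le> D t" "\<And>t. 0 \<le> S t"
    and descent: "\<And>t. t < T \<Longrightarrow>
      e (Suc t) \<le> e t - \<eta>\<^sub>0 / 2 * N t - \<eta>\<^sub>0 / 8 * S t + \<eta>\<^sub>0 / \<gamma>\<^sup>2 * D t"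
    and track: "\<And>t. Suc t < T \<Longrightarrow>
      D (Suc t) \<le> (1 - 2 * (\<eta> * \<alpha>)) * D t + \<eta>\<^sub>0 / (8 * \<alpha>) * S t + C"
    and T: "1 \<le> T"
  shows "(\<Sum>t<T. \<eta> * \<alpha>\<^sup>2 * (\<gamma>\<^sup>2 / 8 * N t + 3 / 4 * D t))
    \<le> e 0 - e T + \<alpha> / 2 * D 0 + real T * (\<alpha> / 2 * C)"
proof -
  \<comment> \<open>There is no tracking step after the last iterate; extending the error by \<open>0\<close> lets the
    recursion run up to \<open>T\<close> all the same.\<close>
  define D' where "D' t = (if t < T then D t else 0)" for t
  have \<eta>\<^sub>0_pos: "0 < \<eta>\<^sub>0" unfolding \<eta>\<^sub>0 using pos by simp
  have track': "D' (Suc t) \<le> (1 - 2 * (\<eta> * \<alpha>)) * D' t + \<eta>\<^sub>0 / (8 * \<alpha>) * S t + C" if "t < T" for t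
  proof (cases "Suc t < T")
    case True
    then show ?thesis using track[OF True] by (simp add: D'_def)
  next
    case False
    have "0 \<le> (1 - 2 * (\<eta> * \<alpha>)) * D' t + \<eta>\<^sub>0 / (8 * \<alpha>) * S t + C"
      using pos nonneg \<eta>\<^sub>0_pos by (intro add_nonneg_nonneg mult_nonneg_nonneg) (auto simp: D'_def)
    then show ?thesis using False by (simp add: D'_def)
  qed
  have "e n + \<alpha> / 2 * D' n + (\<Sum>t<n. \<eta> * \<alpha>\<^sup>2 * (\<gamma>\<^sup>2 / 8 * N t + 3 / 4 * D t))
      \<le> e 0 + \<alpha> / 2 * D 0 + real n * (\<alpha> / 2 * C)" if "n \<le> T" for n
    using that
  proof (induction n)
    case 0
    then show ?case using T by (simp add: D'_def)
  next
    case (Suc n)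
    then have n: "n < T" by simp
    have D'n: "D' n = D n" using n by (simp add: D'_def)
    have "\<alpha> / 2 * D' (Suc n) \<le> \<alpha> / 2 * ((1 - 2 * (\<eta> * \<alpha>)) * D n + \<eta>\<^sub>0 / (8 * \<alpha>) * S n + C)"
      using track'[OF n] pos unfolding D'n by (intro mult_left_mono) auto
    also have "\<dots> = \<alpha> / 2 * D n - \<eta> * \<alpha>\<^sup>2 * D n + \<eta>\<^sub>0 / 16 * S n + \<alpha> / 2 * C"
      using pos by (simp add: field_simps power2_eq_square)
    finally have 1: "\<alpha> / 2 * D' (Suc n) \<le> \<alpha> / 2 * D n - \<eta> * \<alpha>\<^sup>2 * D n + \<eta>\<^sub>0 / 16 * S n + \<alpha> / 2 * C" .
    have 2: "\<eta>\<^sub>0 / 2 * N n = \<eta> * \<alpha>\<^sup>2 * (\<gamma>\<^sup>2 / 8 * N n)" by (simp add: \<eta>\<^sub>0)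
    have 3: "\<eta>\<^sub>0 / \<gamma>\<^sup>2 * D n = 1 / 4 * (\<eta> * \<alpha>\<^sup>2 * D n)" using pos by (simp add: \<eta>\<^sub>0)
    have 4: "\<eta>\<^sub>0 / 16 * S n \<le> \<eta>\<^sub>0 / 8 * S n"
      using \<eta>\<^sub>0_pos nonneg(2)[of n] by (intro mult_right_mono) auto
    have 5: "\<eta> * \<alpha>\<^sup>2 * (\<gamma>\<^sup>2 / 8 * N n + 3 / 4 * D n)
        = \<eta> * \<alpha>\<^sup>2 * (\<gamma>\<^sup>2 / 8 * N n) + 3 / 4 * (\<eta> * \<alpha>\<^sup>2 * D n)" by (simp add: algebra_simps)
    have 6: "real (Suc n) * (\<alpha> / 2 * C) = real n * (\<alpha> / 2 * C) + \<alpha> / 2 * C"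
      by (simp add: algebra_simps)
    have IH: "e n + \<alpha> / 2 * D n + (\<Sum>t<n. \<eta> * \<alpha>\<^sup>2 * (\<gamma>\<^sup>2 / 8 * N t + 3 / 4 * D t))
        \<le> e 0 + \<alpha> / 2 * D 0 + real n * (\<alpha> / 2 * C)"
      using Suc.IH n D'n by simp
    show ?case
      unfolding sum.lessThan_Suc 5 6
      using IH descent[OF n] 1 2 3 4 by linarith
  qed
  from this[of T] show ?thesis by (simp add: D'_def)
qed

text \<open>Write \<open>W = min \<alpha> \<tau> * \<nu>\<close> and \<open>m = min 1 (1/\<gamma>\<^sup>2)\<close>. Both weights on the left of the summed bound are at
  least \<open>W/2\<close>. The horizon makes \<open>\<Delta>\<close> at most a sixteenth, and the step size makes the noise at most a
  forty-eighth, of \<open>T \<eta> m W \<epsilon>\<^sup>2\<close>; together a twelfth, which gives the average \<open>m \<epsilon>\<^sup>2/6\<close>.\<close>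

lemma step_size_and_horizon_suffice:
  fixes \<alpha> \<gamma> \<epsilon> \<tau> \<nu> \<eta> M \<Delta> S\<^sub>1 S\<^sub>2 :: real
  assumes pos: "0 < \<alpha>" "0 < \<gamma>" "0 < \<epsilon>" "0 < M" "0 < \<eta>" "0 \<le> S\<^sub>1" "0 \<le> S\<^sub>2" "1 \<le> T"
    and \<tau>: "\<tau> = \<gamma>\<^sup>2 * \<alpha>\<^sup>2 / 4" and \<nu>: "\<nu> = min 1 (2 * \<tau> / (\<gamma>\<^sup>2 * \<alpha>))"
    and \<eta>: "\<eta> \<le> min 1 (\<gamma>\<^sup>2) * min \<alpha> \<tau> * \<nu> * \<alpha> / (768 * \<tau> * M\<^sup>2) * \<epsilon>\<^sup>2"
    and T: "16 * \<Delta> / (min 1 (1 / \<gamma>\<^sup>2) * min \<alpha> \<tau> * \<nu> * \<epsilon>\<^sup>2) * (1 / \<eta>) \<le> real T"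
    and sum: "\<eta> * \<alpha>\<^sup>2 * (\<gamma>\<^sup>2 / 8 * S\<^sub>1 + 3 / 4 * S\<^sub>2) \<le> \<Delta> + real T * (4 * \<alpha> * \<eta>\<^sup>2 * M\<^sup>2)"
  shows "1 / real T * (S\<^sub>2 + S\<^sub>1) \<le> min 1 (1 / \<gamma>\<^sup>2) * (\<epsilon>\<^sup>2 / 4)"
proof -
  define m where "m = min 1 (1 / \<gamma>\<^sup>2)"
  define W where "W = min \<alpha> \<tau> * \<nu>"
  have \<tau>_pos: "0 < \<tau>" using pos by (simp add: \<tau>)
  have \<nu>': "\<nu> = min 1 (\<alpha> / 2)" using pos by (simp add: \<nu> \<tau> power2_eq_square)
  have \<nu>_pos: "0 < \<nu>" using pos by (simp add: \<nu>')
  have W_pos: "0 < W" using pos \<tau>_pos \<nu>_pos by (simp add: W_def)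
  have m_pos: "0 < m" using pos by (simp add: m_def)
  have m_\<gamma>: "min 1 (\<gamma>\<^sup>2) = \<gamma>\<^sup>2 * m"
    using pos by (simp add: m_def min_mult_distrib_left min.commute)
  have W_le_\<tau>: "W \<le> \<gamma>\<^sup>2 * \<alpha>\<^sup>2 / 4"
  proof -
    have "W \<le> \<tau> * 1" unfolding W_def using \<nu>_pos \<tau>_pos by (intro mult_mono) (auto simp: \<nu>')
    then show ?thesis by (simp add: \<tau>)
  qed
  have W_le_\<alpha>: "W \<le> \<alpha>\<^sup>2 / 2"
  proof -
    have "W \<le> \<alpha> * (\<alpha> / 2)" unfolding W_def using \<nu>_pos pos by (intro mult_mono) (auto simp: \<nu>')
    then show ?thesis by (simp add: power2_eq_square)
  qed
  have "16 * \<Delta> \<le> real T * (m * W * \<epsilon>\<^sup>2 * \<eta>)"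
    using T pos m_pos W_pos unfolding m_def[symmetric] mult.assoc[of m] W_def[symmetric]
    by (simp add: field_simps W_def[symmetric])
  then have 1: "\<Delta> \<le> real T * \<eta> * (m * W * \<epsilon>\<^sup>2) / 16" by (simp add: mult_ac)
  have \<eta>': "\<eta> \<le> m * W * \<epsilon>\<^sup>2 / (192 * \<alpha> * M\<^sup>2)"
  proof -
    have "min 1 (\<gamma>\<^sup>2) * min \<alpha> \<tau> * \<nu> * \<alpha> / (768 * \<tau> * M\<^sup>2) * \<epsilon>\<^sup>2
        = (\<gamma>\<^sup>2 * m) * W * \<alpha> / (768 * (\<gamma>\<^sup>2 * \<alpha>\<^sup>2 / 4) * M\<^sup>2) * \<epsilon>\<^sup>2"
      by (simp add: m_\<gamma> W_def \<tau> mult.assoc)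
    also have "\<dots> = m * W * \<epsilon>\<^sup>2 / (192 * \<alpha> * M\<^sup>2)"
      using pos by (simp add: field_simps power2_eq_square)
    finally show ?thesis using \<eta> by simp
  qed
  have "real T * (4 * \<alpha> * \<eta>\<^sup>2 * M\<^sup>2) = real T * \<eta> * (4 * \<alpha> * M\<^sup>2) * \<eta>"
    by (simp add: power2_eq_square)
  also have "\<dots> \<le> real T * \<eta> * (4 * \<alpha> * M\<^sup>2) * (m * W * \<epsilon>\<^sup>2 / (192 * \<alpha> * M\<^sup>2))"
    using \<eta>' pos by (intro mult_left_mono) auto
  also have "\<dots> = real T * \<eta> * (m * W * \<epsilon>\<^sup>2) / 48" using pos by (simp add: field_simps)
  finally have 2: "real T * (4 * \<alpha> * \<eta>\<^sup>2 * M\<^sup>2) \<le> real T * \<eta> * (m * W * \<epsilon>\<^sup>2) / 48" .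
  have "\<eta> * (W / 2 * (S\<^sub>2 + S\<^sub>1)) = \<eta> * (W / 2 * S\<^sub>1 + W / 2 * S\<^sub>2)" by (simp add: algebra_simps)
  also have "\<dots> \<le> \<eta> * (\<alpha>\<^sup>2 * \<gamma>\<^sup>2 / 8 * S\<^sub>1 + 3 / 4 * \<alpha>\<^sup>2 * S\<^sub>2)"
    using W_le_\<tau> W_le_\<alpha> pos W_pos
    by (intro mult_left_mono add_mono mult_right_mono) (auto simp: mult.commute)
  also have "\<dots> = \<eta> * \<alpha>\<^sup>2 * (\<gamma>\<^sup>2 / 8 * S\<^sub>1 + 3 / 4 * S\<^sub>2)" by (simp add: algebra_simps)
  also have "\<dots> \<le> real T * \<eta> * (m * W * \<epsilon>\<^sup>2) / 12" using sum 1 2 by linarith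
  also have "\<dots> = \<eta> * (W / 2 * (real T * (m * \<epsilon>\<^sup>2) / 6))" by simp
  finally have "S\<^sub>2 + S\<^sub>1 \<le> real T * (m * \<epsilon>\<^sup>2) / 6" using pos W_pos by simp
  then have "1 / real T * (S\<^sub>2 + S\<^sub>1) \<le> m * \<epsilon>\<^sup>2 / 6" using pos(8) by (simp add: field_simps)
  also have "\<dots> \<le> m * (\<epsilon>\<^sup>2 / 4)" using m_pos by simp
  finally show ?thesis unfolding m_def .
qed

section \<open>Convergence of SMAG\<close>

theorem corollaryA3:
  fixes \<phi> \<psi> F\<gamma> :: "'a::euclidean_space \<Rightarrow> real"
    and D\<xi> :: "'b measure" and D\<zeta> :: "'c measure"
    and \<phi>s :: "'a \<Rightarrow> 'b \<Rightarrow> real" and \<psi>s :: "'a \<Rightarrow> 'c \<Rightarrow> real"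
    and G\<phi> :: "'a \<Rightarrow> 'b \<Rightarrow> 'a" and G\<psi> :: "'a \<Rightarrow> 'c \<Rightarrow> 'a"
    and P :: "'w measure" and \<F> :: "nat \<Rightarrow> 'w measure"
    and \<xi> :: "nat \<Rightarrow> 'w \<Rightarrow> 'b" and \<zeta> :: "nat \<Rightarrow> 'w \<Rightarrow> 'c"
    and x\<phi> x\<psi> x :: "nat \<Rightarrow> 'w \<Rightarrow> 'a"
    and x\<phi>0 x\<psi>0 x0 :: 'a
    and \<delta>\<phi> \<delta>\<psi> \<gamma> \<eta>\<^sub>0 \<eta>\<^sub>1 \<alpha> \<tau> \<nu> L\<^sub>F M \<epsilon> Fstar P\<^sub>0 :: real
    and T :: nat
  assumes expectation_\<phi>: "prob_space D\<xi>" "\<And>z. integrable D\<xi> (\<phi>s z)" "\<And>z. \<phi> z = (\<integral>s. \<phi>s z s \<partial>D\<xi>)"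
    and expectation_\<psi>: "prob_space D\<zeta>" "\<And>z. integrable D\<zeta> (\<psi>s z)" "\<And>z. \<psi> z = (\<integral>s. \<psi>s z s \<partial>D\<zeta>)"
    and weakly_convex: "\<delta>\<phi> \<ge> 0" "weakly_convex \<delta>\<phi> \<phi>" "\<delta>\<psi> \<ge> 0" "weakly_convex \<delta>\<psi> \<psi>"
    and F\<gamma>: "\<And>z. F\<gamma> z = moreau \<gamma> \<phi> z - moreau \<gamma> \<psi> z"
    and lower_bound: "\<And>z. Fstar \<le> F\<gamma> z"
    and oracles: "M > 0" "subgradient_oracle D\<xi> \<phi> M G\<phi>" "subgradient_oracle D\<zeta> \<psi> M G\<psi>"
    and prob_space: "prob_space P"
    and samples: "\<And>t. \<xi> t \<in> measurable P D\<xi>" "\<And>t. \<zeta> t \<in> measurable P D\<zeta>"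
    and past: "filtration (space P) \<F>" "\<And>t. subalgebra P (\<F> t)"
      "\<And>t. t < T \<Longrightarrow> x\<phi> t \<in> borel_measurable (\<F> t)"
      "\<And>t. t < T \<Longrightarrow> x\<psi> t \<in> borel_measurable (\<F> t)"
      "\<And>t. t < T \<Longrightarrow> x t \<in> borel_measurable (\<F> t)"
    and cond_\<phi>: "\<And>t. t < T \<Longrightarrow>
      cond_subgradient_estimator P (\<F> t) \<phi> M (x\<phi> t) (\<lambda>\<omega>. G\<phi> (x\<phi> t \<omega>) (\<xi> t \<omega>))"
    and cond_\<psi>: "\<And>t. t < T \<Longrightarrow>
      cond_subgradient_estimator P (\<F> t) \<psi> M (x\<psi> t) (\<lambda>\<omega>. G\<psi> (x\<psi> t \<omega>) (\<zeta> t \<omega>))"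
    and initial: "\<And>\<omega>. \<omega> \<in> space P \<Longrightarrow> x\<phi> 0 \<omega> = x\<phi>0 \<and> x\<psi> 0 \<omega> = x\<psi>0 \<and> x 0 \<omega> = x0"
    and smag: "\<And>\<omega>. \<omega> \<in> space P \<Longrightarrow>
      smag_iterates T \<gamma> \<eta>\<^sub>0 \<eta>\<^sub>1 (\<lambda>t. G\<phi> (x\<phi> t \<omega>) (\<xi> t \<omega>)) (\<lambda>t. G\<psi> (x\<psi> t \<omega>) (\<zeta> t \<omega>))
        (\<lambda>t. x\<phi> t \<omega>) (\<lambda>t. x\<psi> t \<omega>) (\<lambda>t. x t \<omega>)"
    and \<epsilon>: "\<epsilon> > 0"
    (* division in ereal: 1 / 0 = \<infinity>, so a convex function puts no upper bound on \<gamma> *)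
    and \<gamma>: "0 < \<gamma>" "ereal \<gamma> < min (1 / ereal \<delta>\<phi>) (1 / ereal \<delta>\<psi>)"
    and \<alpha>: "\<alpha> = min ((1 / \<gamma> - \<delta>\<phi>) / 2) ((1 / \<gamma> - \<delta>\<psi>) / 2)"
    and \<tau>: "\<tau> = \<gamma>\<^sup>2 * \<alpha>\<^sup>2 / 4"
    and \<nu>: "\<nu> = min 1 (2 * \<tau> / (\<gamma>\<^sup>2 * \<alpha>))"
    and L\<^sub>F: "L\<^sub>F = 2 / (\<gamma> - \<gamma>\<^sup>2 * min \<delta>\<psi> \<delta>\<phi>)"
    and \<eta>\<^sub>1: "\<eta>\<^sub>1 = Min {\<gamma>\<^sup>2 * (1 / \<gamma> - \<delta>\<phi>) / 2, \<gamma>\<^sup>2 * (1 / \<gamma> - \<delta>\<psi>) / 2, 1 / (2 * L\<^sub>F * \<tau>),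
      min 1 (\<gamma>\<^sup>2) * min \<alpha> \<tau> * \<nu> * \<alpha> / (768 * \<tau> * M\<^sup>2) * \<epsilon>\<^sup>2}"
    and \<eta>\<^sub>0: "\<eta>\<^sub>0 = \<tau> * \<eta>\<^sub>1"
    and P\<^sub>0: "P\<^sub>0 = 2 * \<tau> / (\<gamma>\<^sup>2 * \<alpha>) *
      ((\<integral>\<omega>. (norm (x\<phi> 1 \<omega> - prox \<gamma> \<phi> x0))\<^sup>2 \<partial>P) + (\<integral>\<omega>. (norm (x\<psi> 1 \<omega> - prox \<gamma> \<psi> x0))\<^sup>2 \<partial>P))"
    and T: "T \<ge> 1"
      "real T \<ge> 16 * (F\<gamma> x0 - Fstar + P\<^sub>0) / (min 1 (1 / \<gamma>\<^sup>2) * min \<alpha> \<tau> * \<nu> * \<epsilon>\<^sup>2) *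
        Max {2 / (\<gamma>\<^sup>2 * (1 / \<gamma> - \<delta>\<phi>)), 2 / (\<gamma>\<^sup>2 * (1 / \<gamma> - \<delta>\<psi>)), 2 * L\<^sub>F * \<tau>,
          768 * \<tau> * M\<^sup>2 / (min 1 (\<gamma>\<^sup>2) * min \<alpha> \<tau> * \<nu> * \<alpha> * \<epsilon>\<^sup>2)}"
  shows "(\<forall>t<T. integrable P (\<lambda>\<omega>. (norm (x\<phi> (t + 1) \<omega> - prox \<gamma> \<phi> (x t \<omega>)))\<^sup>2) \<and>
              integrable P (\<lambda>\<omega>. (norm (x\<psi> (t + 1) \<omega> - prox \<gamma> \<psi> (x t \<omega>)))\<^sup>2) \<and>
              integrable P (\<lambda>\<omega>. (norm (gradient F\<gamma> (x t \<omega>)))\<^sup>2)) \<and>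
    1 / real T * (\<Sum>t<T.
        (\<integral>\<omega>. (norm (x\<phi> (t + 1) \<omega> - prox \<gamma> \<phi> (x t \<omega>)))\<^sup>2 \<partial>P) +
        (\<integral>\<omega>. (norm (x\<psi> (t + 1) \<omega> - prox \<gamma> \<psi> (x t \<omega>)))\<^sup>2 \<partial>P) +
        (\<integral>\<omega>. (norm (gradient F\<gamma> (x t \<omega>)))\<^sup>2 \<partial>P))
      \<le> min 1 (1 / \<gamma>\<^sup>2) * (\<epsilon>\<^sup>2 / 4) \<and>
    nearly_critical (with_uniform_index P T) \<phi> \<psi> \<epsilon> (\<lambda>(\<omega>, t). x\<phi> t \<omega>) \<and>
    nearly_critical (with_uniform_index P T) \<phi> \<psi> \<epsilon> (\<lambda>(\<omega>, t). x\<psi> t \<omega>)"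
proof -
  interpret P: prob_space P by (rule prob_space)
  \<comment> \<open>For \<open>\<delta> = 0\<close> the upper bound on \<open>\<gamma>\<close> is infinite, and the claim is trivial.\<close>
  have \<gamma>\<delta>: "\<gamma> * \<delta> < 1" if "0 \<le> \<delta>" "ereal \<gamma> < 1 / ereal \<delta>" for \<delta>
  proof (cases "\<delta> = 0")
    case False
    then have "\<gamma> < 1 / \<delta>" using that by (simp add: one_ereal_def)
    then show ?thesis using False that(1) by (simp add: field_simps)
  qed simp
  interpret difference_weakly_convex \<phi> \<psi> \<delta>\<phi> \<delta>\<psi> \<gamma> M
    using weakly_convex \<gamma> \<gamma>\<delta>[of \<delta>\<phi>] \<gamma>\<delta>[of \<delta>\<psi>]
      subgradient_oracle_bounded_selection[OF expectation_\<phi>(1) oracles(2,1)]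
      subgradient_oracle_bounded_selection[OF expectation_\<psi>(1) oracles(3,1)]
    by unfold_locales auto
  have F_eq: "F\<gamma> = envelope" by (rule ext) (simp add: F\<gamma> envelope_def)
  define \<mu>\<phi> where "\<mu>\<phi> = 1 / \<gamma> - \<delta>\<phi>"
  define \<mu>\<psi> where "\<mu>\<psi> = 1 / \<gamma> - \<delta>\<psi>"
  have mod: "A.prox_modulus = \<mu>\<phi>" "B.prox_modulus = \<mu>\<psi>"
    by (simp_all add: A.prox_modulus_def B.prox_modulus_def \<mu>\<phi>_def \<mu>\<psi>_def)
  have \<mu>: "0 < \<mu>\<phi>" "0 < \<mu>\<psi>" using A.\<mu>_pos B.\<mu>_pos by (simp_all add: mod)
  have \<alpha>': "0 < \<alpha>" "\<alpha> \<le> \<mu>\<phi> / 2" "\<alpha> \<le> \<mu>\<psi> / 2"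
    using \<mu> unfolding \<alpha> \<mu>\<phi>_def[symmetric] \<mu>\<psi>_def[symmetric] by auto
  have \<tau>_pos: "0 < \<tau>" using \<alpha>' \<gamma> by (simp add: \<tau>)
  have \<nu>_pos: "0 < \<nu>" using \<alpha>' \<gamma> \<tau>_pos by (simp add: \<nu>)
  have L_pos: "0 < L\<^sub>F"
  proof -
    have "\<gamma> * min \<delta>\<psi> \<delta>\<phi> \<le> \<gamma> * \<delta>\<phi>" using \<gamma>(1) by (intro mult_left_mono) auto
    then have "\<gamma> * (\<gamma> * min \<delta>\<psi> \<delta>\<phi>) < \<gamma> * 1"
      using A.\<gamma>_less \<gamma>(1) by (intro mult_strict_left_mono) linarith+
    then show ?thesis unfolding L\<^sub>F by (simp add: power2_eq_square mult.assoc)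
  qed
  define c where "c = min 1 (\<gamma>\<^sup>2) * min \<alpha> \<tau> * \<nu> * \<alpha> / (768 * \<tau> * M\<^sup>2) * \<epsilon>\<^sup>2"
  have c_pos: "0 < c"
    unfolding c_def using \<alpha>' \<gamma> \<tau>_pos \<nu>_pos oracles(1) \<epsilon> by simp
  let ?steps = "{\<gamma>\<^sup>2 * \<mu>\<phi> / 2, \<gamma>\<^sup>2 * \<mu>\<psi> / 2, 1 / (2 * L\<^sub>F * \<tau>), c}"
  have \<eta>\<^sub>1_Min: "\<eta>\<^sub>1 = Min ?steps"
    unfolding \<eta>\<^sub>1 c_def \<mu>\<phi>_def \<mu>\<psi>_def ..
  have \<eta>: "0 < \<eta>\<^sub>1" "\<eta>\<^sub>1 \<le> \<gamma>\<^sup>2 * \<mu>\<phi> / 2" "\<eta>\<^sub>1 \<le> \<gamma>\<^sup>2 * \<mu>\<psi> / 2" "\<eta>\<^sub>1 \<le> c"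
    unfolding \<eta>\<^sub>1_Min using \<mu> \<gamma> L_pos \<tau>_pos c_pos by (auto simp: min_le_iff_disj)
  note \<eta>A = \<eta>(1,2)[folded mod] and \<eta>B = \<eta>(1,3)[folded mod]
  note \<alpha>A = \<alpha>'(1,2)[folded mod] and \<alpha>B = \<alpha>'(1,3)[folded mod]
  have \<eta>\<^sub>0': "\<eta>\<^sub>0 = \<gamma>\<^sup>2 * \<alpha>\<^sup>2 / 4 * \<eta>\<^sub>1" by (simp add: \<eta>\<^sub>0 \<tau>)
  have \<eta>\<^sub>0_pos: "0 < \<eta>\<^sub>0" using \<eta>(1) \<tau>_pos by (simp add: \<eta>\<^sub>0)
  \<comment> \<open>The descent step needs \<open>\<eta>\<^sub>0\<close> small against the modulus of \<open>\<psi>\<close>; the bound on \<open>\<eta>\<^sub>1\<close> by that modulus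
    and the size of \<open>\<tau>\<close> give this.\<close>
  have \<eta>\<^sub>0_le: "8 * \<eta>\<^sub>0 \<le> \<gamma>\<^sup>2 * B.prox_modulus"
    using B.step_size_products(2)[OF \<alpha>B \<eta>B] \<eta>\<^sub>0_pos unfolding \<eta>\<^sub>0'[symmetric] by linarith

  define G where "G t \<omega> = (1 / \<gamma>) *\<^sub>R (x\<psi> (Suc t) \<omega> - x\<phi> (Suc t) \<omega>)" for t \<omega>
  have step: "x\<phi> (Suc t) \<omega> = x\<phi> t \<omega> - \<eta>\<^sub>1 *\<^sub>R (G\<phi> (x\<phi> t \<omega>) (\<xi> t \<omega>) + (1 / \<gamma>) *\<^sub>R (x\<phi> t \<omega> - x t \<omega>))"
    "x\<psi> (Suc t) \<omega> = x\<psi> t \<omega> - \<eta>\<^sub>1 *\<^sub>R (G\<psi> (x\<psi> t \<omega>) (\<zeta> t \<omega>) + (1 / \<gamma>) *\<^sub>R (x\<psi> t \<omega> - x t \<omega>))"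
    "x (Suc t) \<omega> = x t \<omega> - \<eta>\<^sub>0 *\<^sub>R G t \<omega>" if "\<omega> \<in> space P" "t < T" for t \<omega>
    using smag[OF that(1)] that(2) by (auto simp: smag_iterates_def G_def Let_def)
  \<comment> \<open>Everything below needs second moments of the iterates, which the moment bounds on the estimators
    propagate from the deterministic initial points.\<close>
  have sq: "square_integrable P (x\<phi> t) \<and> square_integrable P (x\<psi> t) \<and> square_integrable P (x t)"
    if "t \<le> T" for t
    using that
  proof (induction t)
    case 0
    have "square_integrable P (\<lambda>_. z)" for z :: 'a
      by (rule P.square_integrable_bounded[where B = "norm z"]) auto
    then show ?case using square_integrable_cong[of P "x\<phi> 0" "\<lambda>_. x\<phi>0"]
      square_integrable_cong[of P "x\<psi> 0" "\<lambda>_. x\<psi>0"] square_integrable_cong[of P "x 0" "\<lambda>_. x0"] initial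
      by auto
  next
    case (Suc t)
    then have t: "t < T" and IH: "square_integrable P (x\<phi> t)" "square_integrable P (x\<psi> t)"
      "square_integrable P (x t)" by auto
    have 1: "square_integrable P (x\<phi> (Suc t))"
      by (rule A.prox_sgd_step(1)[OF prob_space past(2) past(3)[OF t] IH(1) past(5)[OF t] IH(3) cond_\<phi>[OF t] \<eta>A])
        (rule step(1)[OF _ t])
    have 2: "square_integrable P (x\<psi> (Suc t))"
      by (rule B.prox_sgd_step(1)[OF prob_space past(2) past(4)[OF t] IH(2) past(5)[OF t] IH(3) cond_\<psi>[OF t] \<eta>B])
        (rule step(2)[OF _ t])
    have "square_integrable P (\<lambda>\<omega>. x t \<omega> - \<eta>\<^sub>0 *\<^sub>R G t \<omega>)"
      unfolding G_def by (intro square_integrable_diff square_integrable_scaleR 1 2 IH)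
    then have "square_integrable P (x (Suc t))"
      by (subst square_integrable_cong[OF step(3)[OF _ t]])
    with 1 2 show ?case by simp
  qed
  have sq\<phi>: "square_integrable P (x\<phi> t)" and sq\<psi>: "square_integrable P (x\<psi> t)"
    and sqx: "square_integrable P (x t)" if "t \<le> T" for t
    using sq[OF that] by auto
  have sqG: "square_integrable P (G t)" if "t < T" for t
    unfolding G_def using that by (intro square_integrable_scaleR square_integrable_diff sq\<phi> sq\<psi>) auto
  have err\<phi>: "square_integrable P (\<lambda>\<omega>. x\<phi> (Suc t) \<omega> - prox \<gamma> \<phi> (x t \<omega>))"
    and err\<psi>: "square_integrable P (\<lambda>\<omega>. x\<psi> (Suc t) \<omega> - prox \<gamma> \<psi> (x t \<omega>))"
    and sq_grad: "square_integrable P (\<lambda>\<omega>. envelope_gradient (x t \<omega>))" if "t < T" for t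
    using that by (auto intro!: square_integrable_diff sq\<phi> sq\<psi> A.square_integrable_prox
        B.square_integrable_prox square_integrable_envelope_gradient prob_space sqx)

  define E\<phi> where "E\<phi> t = (\<integral>\<omega>. (norm (x\<phi> (Suc t) \<omega> - prox \<gamma> \<phi> (x t \<omega>)))\<^sup>2 \<partial>P)" for t
  define E\<psi> where "E\<psi> t = (\<integral>\<omega>. (norm (x\<psi> (Suc t) \<omega> - prox \<gamma> \<psi> (x t \<omega>)))\<^sup>2 \<partial>P)" for t
  define N where "N t = (\<integral>\<omega>. (norm (envelope_gradient (x t \<omega>)))\<^sup>2 \<partial>P)" for t
  define S where "S t = (\<integral>\<omega>. (norm (G t \<omega>))\<^sup>2 \<partial>P)" for t
  define e where "e t = (\<integral>\<omega>. envelope (x t \<omega>) \<partial>P)" for t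
  have nonneg: "0 \<le> E\<phi> t" "0 \<le> E\<psi> t" "0 \<le> N t" "0 \<le> S t" for t
    by (simp_all add: E\<phi>_def E\<psi>_def N_def S_def)

  have descent: "e (Suc t) \<le> e t - \<eta>\<^sub>0 / 2 * N t - \<eta>\<^sub>0 / 8 * S t + \<eta>\<^sub>0 / \<gamma>\<^sup>2 * (E\<phi> t + E\<psi> t)"
    if t: "t < T" for t
  proof -
    note ints = square_integrable_norm_sq[OF err\<phi>[OF t]] square_integrable_norm_sq[OF err\<psi>[OF t]]
      square_integrable_norm_sq[OF sq_grad[OF t]] square_integrable_norm_sq[OF sqG[OF t]]
      integrable_envelope[OF prob_space sqx[OF less_imp_le[OF t]]]
      integrable_envelope[OF prob_space sqx[OF Suc_leI[OF t]]]
    have "e (Suc t) \<le> (\<integral>\<omega>. envelope (x t \<omega>) - \<eta>\<^sub>0 / 2 * (norm (envelope_gradient (x t \<omega>)))\<^sup>2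
        - \<eta>\<^sub>0 / 8 * (norm (G t \<omega>))\<^sup>2 + \<eta>\<^sub>0 / \<gamma>\<^sup>2 * ((norm (x\<phi> (Suc t) \<omega> - prox \<gamma> \<phi> (x t \<omega>)))\<^sup>2
        + (norm (x\<psi> (Suc t) \<omega> - prox \<gamma> \<psi> (x t \<omega>)))\<^sup>2) \<partial>P)"
      unfolding e_def
      by (intro integral_mono envelope_descent[OF \<eta>\<^sub>0_pos \<eta>\<^sub>0_le G_def step(3)[OF _ t]]
          Bochner_Integration.integrable_add Bochner_Integration.integrable_diff
          integrable_mult_right ints)
    also have "\<dots> = e t - \<eta>\<^sub>0 / 2 * N t - \<eta>\<^sub>0 / 8 * S t + \<eta>\<^sub>0 / \<gamma>\<^sup>2 * (E\<phi> t + E\<psi> t)"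
      using ints by (simp add: e_def N_def S_def E\<phi>_def E\<psi>_def)
    finally show ?thesis .
  qed

  have track: "E\<phi> (Suc t) + E\<psi> (Suc t) \<le> (1 - 2 * (\<eta>\<^sub>1 * \<alpha>)) * (E\<phi> t + E\<psi> t)
      + \<eta>\<^sub>0 / (8 * \<alpha>) * S t + 8 * \<eta>\<^sub>1\<^sup>2 * M\<^sup>2" if Suc_t: "Suc t < T" for t
  proof -
    have t: "t < T" "t \<le> T" "Suc t \<le> T" using Suc_t by auto
    have "(\<integral>\<omega>. (norm (x (Suc t) \<omega> - x t \<omega>))\<^sup>2 \<partial>P) = (\<integral>\<omega>. \<eta>\<^sub>0\<^sup>2 * (norm (G t \<omega>))\<^sup>2 \<partial>P)"
      by (intro Bochner_Integration.integral_cong refl) (simp add: step(3)[OF _ t(1)] power_mult_distrib)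
    also have "\<dots> = \<eta>\<^sub>0\<^sup>2 * S t" by (simp add: S_def)
    finally have shift: "(\<integral>\<omega>. (norm (x (Suc t) \<omega> - x t \<omega>))\<^sup>2 \<partial>P) = \<eta>\<^sub>0\<^sup>2 * S t" .
    \<comment> \<open>The choice of \<open>\<tau>\<close> makes \<open>\<eta>\<^sub>0/\<eta>\<^sub>1 = \<gamma>\<^sup>2 \<alpha>\<^sup>2/4\<close>, which reduces the drift to a fixed fraction of \<open>\<eta>\<^sub>0\<close>.\<close>
    have coeff: "1 / (4 * \<gamma>\<^sup>2 * \<alpha> ^ 3 * \<eta>\<^sub>1) * (\<eta>\<^sub>0\<^sup>2 * S t) = \<eta>\<^sub>0 / (16 * \<alpha>) * S t"
      using \<gamma>(1) \<alpha>'(1) \<eta>(1) unfolding \<eta>\<^sub>0'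
      by (simp add: field_simps power2_eq_square power3_eq_cube)
    have "E\<phi> (Suc t) \<le> (1 - 2 * (\<eta>\<^sub>1 * \<alpha>)) * E\<phi> t + \<eta>\<^sub>0 / (16 * \<alpha>) * S t + 4 * \<eta>\<^sub>1\<^sup>2 * M\<^sup>2"
      using A.prox_tracking_step[OF prob_space past(2) past(3)[OF Suc_t] sq\<phi>[OF t(3)]
          past(5)[OF Suc_t] sqx[OF t(3)] sqx[OF t(2)] cond_\<phi>[OF Suc_t] \<eta>A \<alpha>A step(1)[OF _ Suc_t]]
      unfolding shift coeff E\<phi>_def .
    moreover have "E\<psi> (Suc t) \<le> (1 - 2 * (\<eta>\<^sub>1 * \<alpha>)) * E\<psi> t + \<eta>\<^sub>0 / (16 * \<alpha>) * S t + 4 * \<eta>\<^sub>1\<^sup>2 * M\<^sup>2"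
      using B.prox_tracking_step[OF prob_space past(2) past(4)[OF Suc_t] sq\<psi>[OF t(3)]
          past(5)[OF Suc_t] sqx[OF t(3)] sqx[OF t(2)] cond_\<psi>[OF Suc_t] \<eta>B \<alpha>B step(2)[OF _ Suc_t]]
      unfolding shift coeff E\<psi>_def .
    moreover have "\<eta>\<^sub>0 / (8 * \<alpha>) * S t = \<eta>\<^sub>0 / (16 * \<alpha>) * S t + \<eta>\<^sub>0 / (16 * \<alpha>) * S t" by simp
    ultimately show ?thesis unfolding distrib_left by linarith
  qed

  define \<Delta> where "\<Delta> = F\<gamma> x0 - Fstar + P\<^sub>0"
  have "2 * \<tau> / (\<gamma>\<^sup>2 * \<alpha>) = \<alpha> / 2" using \<gamma>(1) \<alpha>'(1) by (simp add: \<tau> power2_eq_square)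
  moreover have "E\<phi> 0 = (\<integral>\<omega>. (norm (x\<phi> 1 \<omega> - prox \<gamma> \<phi> x0))\<^sup>2 \<partial>P)"
    "E\<psi> 0 = (\<integral>\<omega>. (norm (x\<psi> 1 \<omega> - prox \<gamma> \<psi> x0))\<^sup>2 \<partial>P)"
    unfolding E\<phi>_def E\<psi>_def using initial
    by (auto intro!: Bochner_Integration.integral_cong)
  ultimately have P\<^sub>0': "P\<^sub>0 = \<alpha> / 2 * (E\<phi> 0 + E\<psi> 0)" by (simp only: P\<^sub>0)
  have "e 0 = (\<integral>\<omega>. F\<gamma> x0 \<partial>P)"
    unfolding e_def F_eq using initial by (intro Bochner_Integration.integral_cong) auto
  then have e0: "e 0 = F\<gamma> x0" by (simp add: P.prob_space)
  have "(\<integral>\<omega>. Fstar \<partial>P) \<le> e T"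
    unfolding e_def using lower_bound
    by (intro integral_mono integrable_envelope prob_space sqx) (auto simp: F_eq)
  then have eT: "Fstar \<le> e T" by (simp add: P.prob_space)
  have \<Delta>_nonneg: "0 \<le> \<Delta>"
    unfolding \<Delta>_def P\<^sub>0' using lower_bound[of x0] nonneg \<alpha>'(1)
    by (intro add_nonneg_nonneg mult_nonneg_nonneg) auto

  let ?N = "\<Sum>t<T. N t" and ?E = "\<Sum>t<T. E\<phi> t + E\<psi> t"
  have "(\<Sum>t<T. \<eta>\<^sub>1 * \<alpha>\<^sup>2 * (\<gamma>\<^sup>2 / 8 * N t + 3 / 4 * (E\<phi> t + E\<psi> t)))
      \<le> e 0 - e T + \<alpha> / 2 * (E\<phi> 0 + E\<psi> 0) + real T * (\<alpha> / 2 * (8 * \<eta>\<^sub>1\<^sup>2 * M\<^sup>2))"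
    using \<alpha>'(1) \<gamma>(1) \<eta>(1) _ _ \<eta>\<^sub>0' _ nonneg(4) descent track T(1)
  proof (rule lyapunov_sum_bound)
    show "2 * (\<eta>\<^sub>1 * \<alpha>) \<le> 1"
      using A.step_size_products(1)[OF \<alpha>A \<eta>A] mult_pos_pos[OF \<eta>(1) \<alpha>'(1)] by linarith
  qed (use nonneg in auto)
  also have "\<dots> \<le> \<Delta> + real T * (4 * \<alpha> * \<eta>\<^sub>1\<^sup>2 * M\<^sup>2)"
    using e0 eT by (simp add: \<Delta>_def P\<^sub>0')
  also have "(\<Sum>t<T. \<eta>\<^sub>1 * \<alpha>\<^sup>2 * (\<gamma>\<^sup>2 / 8 * N t + 3 / 4 * (E\<phi> t + E\<psi> t)))
      = \<eta>\<^sub>1 * \<alpha>\<^sup>2 * (\<gamma>\<^sup>2 / 8 * ?N + 3 / 4 * ?E)"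
    by (simp only: sum_distrib_left[symmetric] sum.distrib[of "\<lambda>t. _ * N t"])
  finally have sums: "\<eta>\<^sub>1 * \<alpha>\<^sup>2 * (\<gamma>\<^sup>2 / 8 * ?N + 3 / 4 * ?E) \<le> \<Delta> + real T * (4 * \<alpha> * \<eta>\<^sub>1\<^sup>2 * M\<^sup>2)" .
  have horizon: "16 * \<Delta> / (min 1 (1 / \<gamma>\<^sup>2) * min \<alpha> \<tau> * \<nu> * \<epsilon>\<^sup>2) * (1 / \<eta>\<^sub>1) \<le> real T"
  proof -
    \<comment> \<open>The maximum in the hypothesis on \<open>T\<close> runs over the reciprocals of the candidates for \<open>\<eta>\<^sub>1\<close>.\<close>
    let ?inv = "{2 / (\<gamma>\<^sup>2 * \<mu>\<phi>), 2 / (\<gamma>\<^sup>2 * \<mu>\<psi>), 2 * L\<^sub>F * \<tau>,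
      768 * \<tau> * M\<^sup>2 / (min 1 (\<gamma>\<^sup>2) * min \<alpha> \<tau> * \<nu> * \<alpha> * \<epsilon>\<^sup>2)}"
    have "\<eta>\<^sub>1 \<in> ?steps" unfolding \<eta>\<^sub>1_Min by (rule Min_in) auto
    then have "1 / \<eta>\<^sub>1 \<in> (\<lambda>s. 1 / s) ` ?steps" by (rule imageI)
    also have "(\<lambda>s. 1 / s) ` ?steps = ?inv" by (simp add: c_def)
    finally have "1 / \<eta>\<^sub>1 \<in> ?inv" .
    then have "1 / \<eta>\<^sub>1 \<le> Max ?inv" by (intro Max_ge) auto
    then have "16 * \<Delta> / (min 1 (1 / \<gamma>\<^sup>2) * min \<alpha> \<tau> * \<nu> * \<epsilon>\<^sup>2) * (1 / \<eta>\<^sub>1)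
        \<le> 16 * \<Delta> / (min 1 (1 / \<gamma>\<^sup>2) * min \<alpha> \<tau> * \<nu> * \<epsilon>\<^sup>2) * Max ?inv"
      using \<Delta>_nonneg \<alpha>'(1) \<tau>_pos \<nu>_pos
      by (intro mult_left_mono divide_nonneg_nonneg mult_nonneg_nonneg) auto
    also have "\<dots> \<le> real T" unfolding \<Delta>_def \<mu>\<phi>_def \<mu>\<psi>_def by (rule T(2))
    finally show ?thesis .
  qed
  have mean: "1 / real T * (?E + ?N) \<le> min 1 (1 / \<gamma>\<^sup>2) * (\<epsilon>\<^sup>2 / 4)"
    using step_size_and_horizon_suffice[OF \<alpha>'(1) \<gamma>(1) \<epsilon> oracles(1) \<eta>(1) _ _ T(1) \<tau> \<nu>
        \<eta>(4)[unfolded c_def] horizon sums]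
    by (simp add: sum_nonneg nonneg)

  have E_le: "1 / real T * (\<Sum>t<T. E\<phi> t + N t) \<le> min 1 (1 / \<gamma>\<^sup>2) * (\<epsilon>\<^sup>2 / 4)"
    "1 / real T * (\<Sum>t<T. E\<psi> t + N t) \<le> min 1 (1 / \<gamma>\<^sup>2) * (\<epsilon>\<^sup>2 / 4)"
  proof -
    have "(\<Sum>t<T. E\<phi> t + N t) \<le> ?E + ?N" "(\<Sum>t<T. E\<psi> t + N t) \<le> ?E + ?N"
      unfolding sum.distrib[symmetric] using nonneg by (auto intro!: sum_mono)
    then have "1 / real T * (\<Sum>t<T. E\<phi> t + N t) \<le> 1 / real T * (?E + ?N)"
      "1 / real T * (\<Sum>t<T. E\<psi> t + N t) \<le> 1 / real T * (?E + ?N)"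
      by (auto intro!: divide_right_mono)
    then show "1 / real T * (\<Sum>t<T. E\<phi> t + N t) \<le> min 1 (1 / \<gamma>\<^sup>2) * (\<epsilon>\<^sup>2 / 4)"
      "1 / real T * (\<Sum>t<T. E\<psi> t + N t) \<le> min 1 (1 / \<gamma>\<^sup>2) * (\<epsilon>\<^sup>2 / 4)"
      using mean by linarith+
  qed
  \<comment> \<open>The output \<open>x\<phi> t\<close> tracks the proximal point of the previous centre \<open>x (t - 1)\<close>.\<close>
  have shift_index: "(\<Sum>t\<in>{1..T}. h t) = (\<Sum>t<T. h (Suc t))" for h :: "nat \<Rightarrow> real"
    using sum.atLeast1_atMost_eq[of h T] by simp
  have gap: "norm (\<gamma> *\<^sub>R envelope_gradient z) = norm (prox \<gamma> \<psi> z - prox \<gamma> \<phi> z)" for z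
    using \<gamma>(1) by (simp add: envelope_gradient_eq)
  have idx: "t - 1 < T" "Suc (t - 1) = t" "t \<le> T" "t - 1 \<le> T" if "t \<in> {1..T}" for t
    using that by auto
  have critical\<phi>: "nearly_critical (with_uniform_index P T) \<phi> \<psi> \<epsilon> (\<lambda>(\<omega>, t). x\<phi> t \<omega>)"
  proof (rule nearly_critical_uniform_index[where Y = "\<lambda>t. x (t - 1)"
        and Z = "\<lambda>t \<omega>. x\<phi> t \<omega> - prox \<gamma> \<phi> (x (t - 1) \<omega>)", OF prob_space T(1) \<epsilon>])
    fix t assume t: "t \<in> {1..T}"
    show "square_integrable P (x\<phi> t)" "square_integrable P (x (t - 1))"
      using idx[OF t] by (auto intro: sq\<phi> sqx)
    show "square_integrable P (\<lambda>\<omega>. x\<phi> t \<omega> - prox \<gamma> \<phi> (x (t - 1) \<omega>))"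
      using err\<phi>[of "t - 1"] idx[OF t] by simp
  next
    fix t \<omega>
    let ?p = "prox \<gamma> \<phi> (x (t - 1) \<omega>)" and ?q = "prox \<gamma> \<psi> (x (t - 1) \<omega>)"
    show "norm (x\<phi> t \<omega> - ?p) \<le> norm (x\<phi> t \<omega> - ?p) + norm (\<gamma> *\<^sub>R envelope_gradient (x (t - 1) \<omega>))"
      by simp
    show "norm (x\<phi> t \<omega> - ?q) \<le> norm (x\<phi> t \<omega> - ?p) + norm (\<gamma> *\<^sub>R envelope_gradient (x (t - 1) \<omega>))"
      unfolding gap using norm_triangle_ineq4[of "x\<phi> t \<omega> - ?p" "?q - ?p"] by simp
  qed (use E_le(1)[unfolded E\<phi>_def N_def] in \<open>simp only: shift_index diff_Suc_1\<close>)
  have critical\<psi>: "nearly_critical (with_uniform_index P T) \<phi> \<psi> \<epsilon> (\<lambda>(\<omega>, t). x\<psi> t \<omega>)"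
  proof (rule nearly_critical_uniform_index[where Y = "\<lambda>t. x (t - 1)"
        and Z = "\<lambda>t \<omega>. x\<psi> t \<omega> - prox \<gamma> \<psi> (x (t - 1) \<omega>)", OF prob_space T(1) \<epsilon>])
    fix t assume t: "t \<in> {1..T}"
    show "square_integrable P (x\<psi> t)" "square_integrable P (x (t - 1))"
      using idx[OF t] by (auto intro: sq\<psi> sqx)
    show "square_integrable P (\<lambda>\<omega>. x\<psi> t \<omega> - prox \<gamma> \<psi> (x (t - 1) \<omega>))"
      using err\<psi>[of "t - 1"] idx[OF t] by simp
  next
    fix t \<omega>
    let ?p = "prox \<gamma> \<phi> (x (t - 1) \<omega>)" and ?q = "prox \<gamma> \<psi> (x (t - 1) \<omega>)"
    show "norm (x\<psi> t \<omega> - ?q) \<le> norm (x\<psi> t \<omega> - ?q) + norm (\<gamma> *\<^sub>R envelope_gradient (x (t - 1) \<omega>))"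
      by simp
    show "norm (x\<psi> t \<omega> - ?p) \<le> norm (x\<psi> t \<omega> - ?q) + norm (\<gamma> *\<^sub>R envelope_gradient (x (t - 1) \<omega>))"
      unfolding gap using norm_triangle_ineq[of "x\<psi> t \<omega> - ?q" "?q - ?p"] by simp
  qed (use E_le(2)[unfolded E\<psi>_def N_def] in \<open>simp only: shift_index diff_Suc_1\<close>)
  have grad: "gradient F\<gamma> z = envelope_gradient z" for z
    unfolding F_eq by (rule gradient_envelope)
  show ?thesis
  proof (intro conjI allI impI critical\<phi> critical\<psi>)
    fix t assume t: "t < T"
    show "integrable P (\<lambda>\<omega>. (norm (x\<phi> (t + 1) \<omega> - prox \<gamma> \<phi> (x t \<omega>)))\<^sup>2)"
      using square_integrable_norm_sq[OF err\<phi>[OF t]] by simp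
    show "integrable P (\<lambda>\<omega>. (norm (x\<psi> (t + 1) \<omega> - prox \<gamma> \<psi> (x t \<omega>)))\<^sup>2)"
      using square_integrable_norm_sq[OF err\<psi>[OF t]] by simp
    show "integrable P (\<lambda>\<omega>. (norm (gradient F\<gamma> (x t \<omega>)))\<^sup>2)"
      unfolding grad by (rule square_integrable_norm_sq[OF sq_grad[OF t]])
  qed (use mean in \<open>simp add: grad E\<phi>_def E\<psi>_def N_def sum.distrib\<close>)
qed

end
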